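(* A $3$-dimensional polytope $P\subset\mathbb{R}^3$ is equiprojective if and only if, for every edge direction $u$ of $P$, either (i) $C_P(u)=u^\perp$, or (ii) $C_P(u)$ and the relative interior of $-C_P(u)$ form a partition of $u^\perp$ (i.e. they are disjoint and their union is $u^\perp$).
   Context: A $3$-dimensional polytope $P\subset\mathbb{R}^3$ is $k$-equiprojective when its orthogonal projection onto any plane that is not orthogonal to a facet of $P$ is a polygon with exactly $k$ vertices; it is equiprojective if it is $k$-equiprojective for some $k$. For a polytope $P\subset\mathbb{R}^3$ and a face $F$ of $P$, the normal cone is $N_P(F)=\{u\in\mathbb{R}^3:\ u\cdot x\le u\cdot y \text{ for all } x\in P,\ y\in F\}$; normal cones at edges are $2$-dimensional. For a non-zero $u\in\mathbb{R}^3$, the aggregated cone $C_P(u)$ is the union of all $2$-dimensional normal cones of $P$ that are contained in the plane $u^\perp$. A vector $u\in\mathbb{S}^2$ is an edge direction of $P$ when its first non-zero coordinate is positive and some edge of $P$ has its difference of vertices equal to a multiple of $u$. *)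

theory Defs
  imports "HOL-Analysis.Analysis"
begin

text \<open>Orthogonal projection of R^3 onto the plane through the origin with normal n
  (projections onto parallel affine planes differ only by a translation).\<close>
definition proj_along :: "real^3 \<Rightarrow> real^3 \<Rightarrow> real^3" where
  "proj_along n x = x - ((x \<bullet> n) / (n \<bullet> n)) *\<^sub>R n"

text \<open>The plane with normal n is orthogonal to the facet F iff n is parallel to F.\<close>
definition plane_orth_facet :: "real^3 \<Rightarrow> (real^3) set \<Rightarrow> bool" where
  "plane_orth_facet n F \<longleftrightarrow> n \<in> span {x - y | x y. x \<in> F \<and> y \<in> F}"

definition k_equiprojective :: "nat \<Rightarrow> (real^3) set \<Rightarrow> bool" where
  "k_equiprojective k P \<longleftrightarrow>
     (\<forall>n. n \<noteq> 0 \<and> (\<forall>F. F facet_of P \<longrightarrow> \<not> plane_orth_facet n F) \<longrightarrow>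
        card {v. v extreme_point_of (proj_along n ` P)} = k)"

definition equiprojective :: "(real^3) set \<Rightarrow> bool" where
  "equiprojective P \<longleftrightarrow> (\<exists>k. k_equiprojective k P)"

definition normal_cone :: "(real^3) set \<Rightarrow> (real^3) set \<Rightarrow> (real^3) set" where
  "normal_cone P F = {u. \<forall>x\<in>P. \<forall>y\<in>F. u \<bullet> x \<le> u \<bullet> y}"

definition aggregated_cone :: "(real^3) set \<Rightarrow> real^3 \<Rightarrow> (real^3) set" where
  "aggregated_cone P u =
     \<Union>{normal_cone P F | F. F face_of P \<and> aff_dim (normal_cone P F) = 2
                           \<and> normal_cone P F \<subseteq> {x. x \<bullet> u = 0}}"

definition first_nonzero_pos :: "real^3 \<Rightarrow> bool" where
  "first_nonzero_pos u \<longleftrightarrow>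
     u $ 1 > 0 \<or> (u $ 1 = 0 \<and> u $ 2 > 0) \<or> (u $ 1 = 0 \<and> u $ 2 = 0 \<and> u $ 3 > 0)"

definition edge_direction :: "(real^3) set \<Rightarrow> real^3 \<Rightarrow> bool" where
  "edge_direction P u \<longleftrightarrow> norm u = 1 \<and> first_nonzero_pos u \<and>
     (\<exists>E a b c. E edge_of P \<and> a extreme_point_of E \<and> b extreme_point_of E \<and> a \<noteq> b
                \<and> a - b = c *\<^sub>R u)"

end

theory Submission
  imports Defs
begin

text \<open>
  For a direction \<open>n\<close> parallel to no facet, the projection along \<open>n\<close> is a polygon whose edges are
  the images of the edges \<open>G\<close> of \<open>P\<close> whose normal cone meets \<open>n\<^sup>\<bottom>\<close> away from \<open>0\<close> (the silhouette);
  if \<open>G\<close> is the intersection of facets with normals \<open>a, b\<close>, this says \<open>(n \<bullet> a) (n \<bullet> b) < 0\<close>.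
  The silhouette edges of direction \<open>u\<close> number \<open>[r \<in> C] + [- r \<in> C]\<close>, where \<open>r = u \<times> n\<close> and
  \<open>C\<close> is the aggregated cone of \<open>u\<close>. Under (i) or (ii) this count is 2 or 1, independently of \<open>n\<close>.

  Conversely, fix an edge direction \<open>u\<close>, a generic \<open>r \<in> u\<^sup>\<bottom>\<close>, and compare the directions
  \<open>u \<plusminus> \<delta> (r \<times> u)\<close> for small \<open>\<delta>\<close>. Both see \<open>[r \<in> C] + [- r \<in> C]\<close> edges parallel to \<open>u\<close>. Any other
  edge has at most one of its facet normals \<open>a, b\<close> orthogonal to \<open>u\<close>: if exactly one is, the edge is in
  exactly one of the two silhouettes; if none is, its status is decided by the sign of
  \<open>(u \<bullet> a) (u \<bullet> b)\<close>. So these edges contribute a total independent of \<open>r\<close>, whence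
  \<open>[r \<in> C] + [- r \<in> C]\<close> is the same for all generic \<open>r\<close>, and (i) or (ii) follows by density.
\<close>

unbundle cross3_syntax

section \<open>Faces of polytopes\<close>

text \<open>The face of \<open>P\<close> exposed by the functional \<open>r\<close>, all of
  \<open>P\<close> when \<open>r = 0\<close>. Normal cones are handled through it: for
  \<open>F \<subseteq> P\<close>, \<open>r\<close> is in the normal cone at \<open>F\<close> iff
  \<open>F \<subseteq> max_face P r\<close>.\<close>

definition max_face :: "'a::euclidean_space set \<Rightarrow> 'a \<Rightarrow> 'a set" where
  "max_face P r = {x \<in> P. \<forall>y\<in>P. r \<bullet> y \<le> r \<bullet> x}"

lemma max_face_eq_Int_hyperplane:
  assumes "x \<in> max_face P r"
  shows "max_face P r = P \<inter> {y. r \<bullet> y = r \<bullet> x}"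
  using assms by (force simp: max_face_def)

lemma max_face_subset: "max_face P r \<subseteq> P"
  by (auto simp: max_face_def)

lemma max_face_face_of:
  assumes "convex P"
  shows "max_face P r face_of P"
proof (cases "max_face P r = {}")
  case False
  then obtain x where x: "x \<in> max_face P r" by blast
  have "P \<inter> {y. r \<bullet> y = r \<bullet> x} face_of P"
    using x by (intro face_of_Int_supporting_hyperplane_le assms) (auto simp: max_face_def)
  then show ?thesis
    by (simp add: max_face_eq_Int_hyperplane[OF x])
qed simp

lemma max_face_nonempty:
  assumes "compact P" "P \<noteq> {}"
  shows "max_face P r \<noteq> {}"
proof -
  have "continuous_on P (\<lambda>x. r \<bullet> x)" by (intro continuous_intros)
  from continuous_attains_sup[OF assms this] show ?thesis
    by (auto simp: max_face_def)
qed

lemma max_face_scaleR: "c > 0 \<Longrightarrow> max_face P (c *\<^sub>R r) = max_face P r"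
  by (simp add: max_face_def)

text \<open>At a common maximiser neither summand can be exceeded, so a point maximises the sum only
  by maximising both summands.\<close>

lemma max_face_add:
  assumes "max_face P r \<inter> max_face P s \<noteq> {}"
  shows "max_face P (r + s) = max_face P r \<inter> max_face P s"
proof -
  obtain z where z: "z \<in> max_face P r" "z \<in> max_face P s" using assms by blast
  then have zP: "z \<in> P" "\<And>y. y \<in> P \<Longrightarrow> r \<bullet> y \<le> r \<bullet> z" "\<And>y. y \<in> P \<Longrightarrow> s \<bullet> y \<le> s \<bullet> z"
    by (auto simp: max_face_def)
  then have "z \<in> max_face P (r + s)" by (auto simp: max_face_def inner_add_left add_mono)
  then have "max_face P (r + s) = P \<inter> {y. r \<bullet> y + s \<bullet> y = r \<bullet> z + s \<bullet> z}"
    using max_face_eq_Int_hyperplane[of z P "r + s"] by (simp add: inner_add_left)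
  also have "\<dots> = P \<inter> {y. r \<bullet> y = r \<bullet> z} \<inter> {y. s \<bullet> y = s \<bullet> z}"
    using zP by fastforce
  finally show ?thesis
    using z by (auto simp: max_face_eq_Int_hyperplane[OF z(1)] max_face_eq_Int_hyperplane[OF z(2)])
qed

text \<open>Faces of polyhedra are exposed, so a supporting hyperplane provides the
  functional.\<close>

lemma face_eq_max_face:
  assumes "polyhedron P" "F face_of P" "F \<noteq> {}" "F \<noteq> P"
  obtains r where "r \<noteq> 0" "F = max_face P r"
proof -
  have "F exposed_face_of P" using assms by (simp add: exposed_face_of_polyhedron)
  then obtain a b where ab: "a \<noteq> 0" "P \<subseteq> {x. a \<bullet> x \<le> b}" "F = P \<inter> {x. a \<bullet> x = b}"
    using assms by (auto simp: exposed_face_of)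
  then have "F = max_face P a" using \<open>F \<noteq> {}\<close> by (force simp: max_face_def)
  with ab that show ?thesis by blast
qed

lemma face_of_eq_if_aff_dim_ge:
  fixes P :: "'a::euclidean_space set"
  assumes "F face_of P" "G face_of P" "F \<subseteq> G" "aff_dim G \<le> aff_dim F"
  shows "F = G"
proof (rule ccontr)
  assume "F \<noteq> G"
  moreover have "F face_of G" using assms face_of_face by blast
  ultimately have "aff_dim F < aff_dim G"
    using assms face_of_aff_dim_lt face_of_imp_convex by blast
  with assms show False by simp
qed

text \<open>\<open>G\<close> is the intersection of the facets containing it, and a single facet is
  too large, so there are two. Their intersection is a face containing \<open>G\<close> of dimension
  below that of a facet, hence no larger than \<open>G\<close>.\<close>

lemma ridge_eq_Int_facets:
  assumes P: "polyhedron P" and G: "G face_of P" "G \<noteq> {}" "aff_dim G = aff_dim P - 2"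
  obtains F1 F2 where "F1 facet_of P" "F2 facet_of P" "F1 \<noteq> F2" "G = F1 \<inter> F2"
proof -
  have "G \<noteq> P" using G by auto
  then have G_eq: "G = \<Inter>{F. F facet_of P \<and> G \<subseteq> F}"
    using face_of_polyhedron P G by blast
  obtain F1 where F1: "F1 facet_of P" "G \<subseteq> F1"
    using face_of_polyhedron_subset_facet P G \<open>G \<noteq> P\<close> by metis
  have "G \<noteq> F1" using F1 G by (auto simp: facet_of_def)
  moreover have "G = F1" if "{F. F facet_of P \<and> G \<subseteq> F} = {F1}"
    using G_eq unfolding that by simp
  ultimately obtain F2 where F2: "F2 facet_of P" "G \<subseteq> F2" "F2 \<noteq> F1"
    using F1 by blast
  have "\<not> F1 \<subseteq> F2"
    using face_of_eq_if_aff_dim_ge[of F1 P F2] F1 F2 by (auto simp: facet_of_def)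
  have Int: "F1 \<inter> F2 face_of P" using F1 F2 by (simp add: face_of_Int facet_of_imp_face_of)
  then have "F1 \<inter> F2 face_of F1"
    using F1 by (meson face_of_face facet_of_imp_face_of inf_le1)
  moreover have "convex F1" using F1 by (meson face_of_imp_convex facet_of_imp_face_of)
  moreover have "F1 \<inter> F2 \<noteq> F1" using \<open>\<not> F1 \<subseteq> F2\<close> by blast
  ultimately have "aff_dim (F1 \<inter> F2) < aff_dim F1"
    using face_of_aff_dim_lt by blast
  then have "aff_dim (F1 \<inter> F2) \<le> aff_dim G"
    using F1 G by (simp add: facet_of_def)
  then have "G = F1 \<inter> F2"
    using face_of_eq_if_aff_dim_ge[OF G(1) Int] F1 F2 by simp
  with F1 F2 that show ?thesis by blast
qed

section \<open>Segments, and the vertices and edges of polygons\<close>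

lemma polytope_aff_dim_1_segment:
  fixes S :: "'a::euclidean_space set"
  assumes "polytope S" "aff_dim S = 1"
  obtains a b where "a \<noteq> b" "S = closed_segment a b"
proof -
  have "compact S" "convex S" "S \<noteq> {}" "collinear S"
    using assms by (auto simp: polytope_imp_compact polytope_imp_convex collinear_aff_dim)
  then obtain a b where "S = closed_segment a b" using compact_convex_collinear_segment by blast
  moreover have "a \<noteq> b" using assms calculation by auto
  ultimately show ?thesis using that by blast
qed

text \<open>Three edges at a vertex of a polygon would have pairwise non-parallel directions
  \<open>d\<^sub>1, d\<^sub>2, d\<^sub>3\<close> with \<open>d\<^sub>3\<close> a combination of \<open>d\<^sub>1, d\<^sub>2\<close>; the supporting functionals of the
  first two edges force positive coefficients, which that of the third edge forbids.\<close>

lemma polygon_three_edges_at_vertex: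
  fixes Q :: "'a::euclidean_space set"
  assumes Q: "polytope Q" "aff_dim Q = 2"
    and e: "e1 facet_of Q" "e2 facet_of Q" "e3 facet_of Q"
    and v: "v \<in> e1" "v \<in> e2" "v \<in> e3"
    and ne: "e1 \<noteq> e2" "e1 \<noteq> e3" "e2 \<noteq> e3"
  shows False
proof -
  have poly: "polyhedron Q" using Q polytope_imp_polyhedron by blast
  have vQ: "v \<in> Q" using e v facet_of_imp_subset by blast
  have int: "\<exists>x. x \<in> e \<and> x \<notin> e'"
    if "e facet_of Q" "e' facet_of Q" "e \<noteq> e'" for e e'
    using face_of_eq_if_aff_dim_ge[of e Q e'] that by (auto simp: facet_of_def)
  have Int: "e \<inter> e' = {v}" 
    if "e facet_of Q" "e' facet_of Q" "e \<noteq> e'" "v \<in> e" "v \<in> e'" for e e'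
  proof -
    have face: "e \<inter> e' face_of Q" using that by (simp add: face_of_Int facet_of_imp_face_of)
    then have "e \<inter> e' face_of e" using that by (meson face_of_face facet_of_imp_face_of inf_le1)
    moreover have "e \<inter> e' \<noteq> e" using int that by blast
    ultimately have "aff_dim (e \<inter> e') < aff_dim e"
      using that by (meson face_of_aff_dim_lt face_of_imp_convex facet_of_imp_face_of)
    then have "aff_dim (e \<inter> e') \<le> 0" using that Q by (simp add: facet_of_def)
    moreover have "aff_dim (e \<inter> e') \<noteq> -1" using that aff_dim_empty[of "e \<inter> e'"] by blast
    ultimately have "aff_dim (e \<inter> e') = 0" using aff_dim_geq[of "e \<inter> e'"] by linarith
    then obtain a where "e \<inter> e' = {a}" using aff_dim_eq_0 by blast
    moreover have "v \<in> e \<inter> e'" using that by blast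
    ultimately show ?thesis by simp
  qed
  have pick: "\<exists>x m. x \<in> e \<and> x \<noteq> v \<and> e = max_face Q m" if "e facet_of Q" "v \<in> e" for e
  proof -
    have "aff_dim e = 1" using that Q by (simp add: facet_of_def)
    then have "e \<noteq> {v}" by auto
    then obtain x where "x \<in> e" "x \<noteq> v" using \<open>v \<in> e\<close> by blast
    moreover have "e face_of Q" "e \<noteq> {}" "e \<noteq> Q"
      using that facet_of_irrefl by (auto simp: facet_of_imp_face_of)
    ultimately show ?thesis using face_eq_max_face[OF poly] by metis
  qed
  obtain x1 m1 where 1: "x1 \<in> e1" "x1 \<noteq> v" "e1 = max_face Q m1" using pick e v by blast
  obtain x2 m2 where 2: "x2 \<in> e2" "x2 \<noteq> v" "e2 = max_face Q m2" using pick e v by blast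
  obtain x3 m3 where 3: "x3 \<in> e3" "x3 \<noteq> v" "e3 = max_face Q m3" using pick e v by blast
  define d1 d2 d3 where d: "d1 = x1 - v" "d2 = x2 - v" "d3 = x3 - v"
  have in_Q: "x1 \<in> Q" "x2 \<in> Q" "x3 \<in> Q"
    using 1 2 3 by (auto simp: max_face_def)
  have zero: "m \<bullet> (x - v) = 0" if "v \<in> max_face Q m" "x \<in> max_face Q m" for m x
    using that by (force simp: max_face_def inner_diff_right intro: antisym)
  have neg: "m \<bullet> (x - v) < 0" if "v \<in> max_face Q m" "x \<in> Q" "x \<notin> max_face Q m" for m x
    using that by (force simp: max_face_def inner_diff_right)
  have notin: "x1 \<notin> e2" "x1 \<notin> e3" "x2 \<notin> e1" "x2 \<notin> e3" "x3 \<notin> e1" "x3 \<notin> e2"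
    using Int e v ne 1 2 3 by blast+
  have s1: "m1 \<bullet> d1 = 0" "m1 \<bullet> d2 < 0" "m1 \<bullet> d3 < 0"
    and s2: "m2 \<bullet> d1 < 0" "m2 \<bullet> d2 = 0" "m2 \<bullet> d3 < 0"
    and s3: "m3 \<bullet> d1 < 0" "m3 \<bullet> d2 < 0" "m3 \<bullet> d3 = 0"
    using zero neg notin 1 2 3 v in_Q unfolding d by simp_all
  have indep: "independent {d1, d2}"
  proof -
    have "d2 \<noteq> 0" using 2 d by simp
    moreover have "d1 \<notin> span {d2}" using s2 by (auto simp: span_singleton)
    ultimately show ?thesis
      by (simp add: independent_insert)
  qed
  have "d1 \<noteq> d2" using s1 by auto
  have "dim ((\<lambda>x. x - v) ` Q) = 2"
    using aff_dim_eq_dim_subtract[of v Q] vQ Q by (simp add: hull_inc)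
  moreover have "{d1, d2} \<subseteq> (\<lambda>x. x - v) ` Q" "d3 \<in> (\<lambda>x. x - v) ` Q" using in_Q d by auto
  ultimately have "d3 \<in> span {d1, d2}"
    using card_eq_dim[of "{d1,d2}" "(\<lambda>x. x - v) ` Q"] indep \<open>d1 \<noteq> d2\<close> by auto
  then obtain \<alpha> where "d3 - \<alpha> *\<^sub>R d1 \<in> span {d2}" using span_breakdown_eq by blast
  then obtain \<beta> where "d3 - \<alpha> *\<^sub>R d1 = \<beta> *\<^sub>R d2" by (auto simp: span_singleton)
  then have d3: "d3 = \<alpha> *\<^sub>R d1 + \<beta> *\<^sub>R d2" by (simp add: algebra_simps)
  have "\<beta> > 0" using s1 d3 by (simp add: inner_add_right mult_less_0_iff)
  moreover have "\<alpha> > 0" using s2 d3 by (simp add: inner_add_right mult_less_0_iff)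
  ultimately have "\<alpha> * (m3 \<bullet> d1) < 0" "\<beta> * (m3 \<bullet> d2) < 0"
    using s3 by (simp_all add: mult_pos_neg)
  with s3(3) show False unfolding d3 by (simp add: inner_add_right)
qed

text \<open>Double counting of incidences: a vertex has codimension 2, so it lies on two edges, and
  a third is excluded; an edge is a segment, so it has two vertices.\<close>

lemma polygon_card_vertices_eq_card_edges:
  fixes Q :: "'a::euclidean_space set"
  assumes Q: "polytope Q" "aff_dim Q = 2"
  shows "card {v. v extreme_point_of Q} = card {e. e facet_of Q}"
proof -
  have poly: "polyhedron Q" using Q polytope_imp_polyhedron by blast
  let ?V = "{v. v extreme_point_of Q}" and ?E = "{e. e facet_of Q}"
  have fin: "finite ?V" "finite ?E"
    using poly finite_polyhedron_extreme_points finite_polyhedron_facets by blast+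
  have "card {e \<in> ?E. v \<in> e} = 2" if "v \<in> ?V" for v
  proof -
    have "{v} face_of Q" using that by (simp add: face_of_singleton)
    then obtain e1 e2 where e: "e1 facet_of Q" "e2 facet_of Q" "e1 \<noteq> e2" "{v} = e1 \<inter> e2"
      using ridge_eq_Int_facets[OF poly, of "{v}"] Q by auto
    then have "{e \<in> ?E. v \<in> e} = {e1, e2}"
      using polygon_three_edges_at_vertex[OF Q] by blast
    with e show ?thesis by simp
  qed
  moreover have "card {v \<in> ?V. v \<in> e} = 2" if "e \<in> ?E" for e
  proof -
    have e: "e face_of Q" "aff_dim e = 1" using that Q by (auto simp: facet_of_def)
    then obtain a b where ab: "a \<noteq> b" "e = closed_segment a b"
      using polytope_aff_dim_1_segment face_of_polytope_polytope Q by metis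
    have "{v \<in> ?V. v \<in> e} = {v. v extreme_point_of e}"
      using extreme_point_of_face[OF e(1)] by auto
    also have "\<dots> = {a, b}" using ab extreme_point_of_segment by blast
    finally show ?thesis using ab by simp
  qed
  ultimately have "2 * card ?V = 2 * card ?E"
    using sum_multicount[OF fin(2) fin(1), of "\<lambda>e v. v \<in> e" 2] 
    by (simp add: sum.cong)
  then show ?thesis by simp
qed

section \<open>Cross products and projections\<close>

text \<open>The Lagrange identity makes \<open>x \<times> (a \<times> b)\<close> a combination of
  \<open>a\<close> and \<open>b\<close> with coefficients \<open>x \<bullet> b\<close> and
  \<open>- (x \<bullet> a)\<close>, both zero.\<close>

lemma orthogonal_two_parallel_cross:
  fixes a b x :: "real^3"
  assumes "a \<times> b \<noteq> 0" "x \<bullet> a = 0" "x \<bullet> b = 0"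
  obtains c where "x = c *\<^sub>R (a \<times> b)"
proof -
  have "x \<times> (a \<times> b) = 0" using assms by (simp add: Lagrange)
  then have "(a \<times> b) \<times> x = 0" by (metis cross_skew neg_equal_0_iff_equal)
  then have "x = 0 \<or> (\<exists>c. x = c *\<^sub>R (a \<times> b))"
    using assms(1) by (auto simp: cross_eq_0 collinear_lemma)
  then show ?thesis using that[of 0] that by auto
qed

lemma cross_eq_0_parallel:
  fixes a b :: "real^3"
  assumes "a \<times> b = 0" "a \<noteq> 0"
  obtains c where "b = c *\<^sub>R a"
  using assms that[of 0] that by (auto simp: cross_eq_0 collinear_lemma)

text \<open>With \<open>w = a \<times> b\<close>, which is parallel to \<open>u\<close>,
  \<open>r\<close> is orthogonal to \<open>w\<close>, so \<open>w \<times> (r \<times> w)\<close> is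
  \<open>r\<close> scaled by \<open>w \<bullet> w\<close>. Expanding the same product by the
  Lagrange identity gives explicit coefficients.\<close>

lemma orthogonal_in_span_two:
  fixes a b u r :: "real^3"
  assumes "a \<times> b \<noteq> 0" "u \<noteq> 0" "a \<bullet> u = 0" "b \<bullet> u = 0" "r \<bullet> u = 0"
  obtains \<alpha> \<beta> where "r = \<alpha> *\<^sub>R a + \<beta> *\<^sub>R b"
proof -
  obtain c where c: "u = c *\<^sub>R (a \<times> b)"
    using orthogonal_two_parallel_cross[of a b u] assms by (metis inner_commute)
  let ?w = "a \<times> b"
  have rw: "r \<bullet> ?w = 0" using assms c by auto
  have "?w \<times> (r \<times> ?w) = (?w \<bullet> ?w) *\<^sub>R r"
    using rw Lagrange[of ?w r ?w] by (simp add: inner_commute)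
  moreover have "r \<times> ?w = (r \<bullet> b) *\<^sub>R a - (r \<bullet> a) *\<^sub>R b" by (simp add: Lagrange)
  moreover have "?w \<times> a = (a \<bullet> a) *\<^sub>R b - (a \<bullet> b) *\<^sub>R a"
    using cross_skew[of ?w a] by (simp add: Lagrange)
  moreover have "?w \<times> b = (a \<bullet> b) *\<^sub>R b - (b \<bullet> b) *\<^sub>R a"
    using cross_skew[of ?w b] by (simp add: Lagrange inner_commute)
  ultimately have eq: "(?w \<bullet> ?w) *\<^sub>R r =
      (r \<bullet> b) *\<^sub>R ((a \<bullet> a) *\<^sub>R b - (a \<bullet> b) *\<^sub>R a) - (r \<bullet> a) *\<^sub>R ((a \<bullet> b) *\<^sub>R b - (b \<bullet> b) *\<^sub>R a)"
    by (simp add: Cross3.right_diff_distrib cross_mult_right)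
  have "r = (1 / (?w \<bullet> ?w)) *\<^sub>R ((?w \<bullet> ?w) *\<^sub>R r)" using assms(1) by simp
  also have "\<dots> = ((- (r \<bullet> b) * (a \<bullet> b) + (r \<bullet> a) * (b \<bullet> b)) / (?w \<bullet> ?w)) *\<^sub>R a
     + (((r \<bullet> b) * (a \<bullet> a) - (r \<bullet> a) * (a \<bullet> b)) / (?w \<bullet> ?w)) *\<^sub>R b"
    unfolding eq by (simp add: algebra_simps add_divide_distrib diff_divide_distrib)
  finally show ?thesis using that by blast
qed

lemma proj_along_inner_left: "r \<bullet> n = 0 \<Longrightarrow> r \<bullet> proj_along n x = r \<bullet> x"
  by (simp add: proj_along_def inner_diff_right)

lemma proj_along_orthogonal: "n \<noteq> 0 \<Longrightarrow> proj_along n x \<bullet> n = 0"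
  by (simp add: proj_along_def inner_diff_left)

lemma linear_proj_along: "linear (proj_along n)"
  unfolding proj_along_def
  by (rule linearI) (auto simp: algebra_simps inner_add_left add_divide_distrib)

section \<open>Auxiliary facts on roots and signs\<close>

lemma finite_quadratic_roots:
  fixes a b c :: real
  assumes "b \<noteq> 0 \<or> c \<noteq> 0"
  shows "finite {t. a + t * b + t\<^sup>2 * c = 0}"
proof -
  have "finite {t. poly [:a, b, c:] t = 0}" using assms by (intro poly_roots_finite) auto
  moreover have "{t. poly [:a, b, c:] t = 0} = {t. a + t * b + t\<^sup>2 * c = 0}"
    by (simp add: algebra_simps power2_eq_square)
  ultimately show ?thesis by simp
qed

lemma first_nonzero_pos_uminus:
  "u \<noteq> 0 \<Longrightarrow> first_nonzero_pos (- u) \<longleftrightarrow> \<not> first_nonzero_pos u"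
  by (auto simp: first_nonzero_pos_def vec_eq_iff forall_3)

text \<open>Here \<open>a\<close>, \<open>b\<close> stand for the values of \<open>u\<close> on the
  two facet normals of an edge and \<open>a'\<close>, \<open>b'\<close> for their small
  perturbations; a negative product means that the edge is in the silhouette. If \<open>a\<close>
  and \<open>b\<close> are non-zero, both products keep the sign of \<open>a * b\<close>; if one of
  them vanishes, that factor changes sign between the two products and the other does not.\<close>

lemma sign_change_pair_count:
  fixes a b a' b' :: real
  assumes "a = 0 \<Longrightarrow> a' \<noteq> 0" "b = 0 \<Longrightarrow> b' \<noteq> 0" "a \<noteq> 0 \<Longrightarrow> \<bar>a'\<bar> < \<bar>a\<bar>" "b \<noteq> 0 \<Longrightarrow> \<bar>b'\<bar> < \<bar>b\<bar>"
    "a \<noteq> 0 \<or> b \<noteq> 0"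
  shows "of_bool ((a + a') * (b + b') < 0) + of_bool ((a - a') * (b - b') < 0) =
    (if a * b < 0 then 2 else if a * b = 0 then 1 else 0 :: nat)"
proof -
  consider "a = 0" "b \<noteq> 0" | "a \<noteq> 0" "b = 0" | "a > 0" "b > 0" | "a > 0" "b < 0"
    | "a < 0" "b > 0" | "a < 0" "b < 0"
    using assms(5) by linarith
  then show ?thesis
    by cases (use assms in \<open>auto simp: mult_less_0_iff zero_less_mult_iff of_bool_def abs_if split: if_splits\<close>)
qed

section \<open>Silhouettes\<close>

locale polytope3 =
  fixes P :: "(real^3) set"
  assumes polytope: "polytope P" and aff_dim: "aff_dim P = 3"
begin

lemma polyhedron: "polyhedron P"
  using polytope polytope_imp_polyhedron by blast

lemma convex: "convex P"
  using polytope polytope_imp_convex by blast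

lemma nonempty: "P \<noteq> {}"
  using aff_dim by auto

lemma compact: "compact P"
  using polytope polytope_imp_compact by blast

lemma max_face_face: "max_face P r face_of P"
  using max_face_face_of convex by blast

text \<open>A full-dimensional \<open>P\<close> does not fit into a hyperplane.\<close>

lemma max_face_neq: 
  assumes "r \<noteq> 0"
  shows "max_face P r \<noteq> P"
proof
  assume eq: "max_face P r = P"
  obtain x where "x \<in> P" using nonempty by blast
  then have "P \<subseteq> {y. r \<bullet> y = r \<bullet> x}"
    using max_face_eq_Int_hyperplane[of x P r] eq by auto
  then have "aff_dim P \<le> aff_dim {y. r \<bullet> y = r \<bullet> x}" by (rule aff_dim_subset)
  then show False using aff_dim assms by simp
qed

lemma max_face_opposite:
  assumes "r \<noteq> 0"
  shows "max_face P r \<inter> max_face P (- r) = {}"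
proof (rule ccontr)
  assume "\<not> ?thesis"
  then obtain x where x: "x \<in> max_face P r" "x \<in> max_face P (- r)" by blast
  then have "max_face P r = P" by (force simp: max_face_def)
  then show False using max_face_neq assms by blast
qed

lemma face_aff_dim_le_1:
  assumes "F face_of P" "F \<noteq> P" "\<not> F facet_of P"
  shows "aff_dim F \<le> 1"
proof -
  have "aff_dim F < 3" using face_of_aff_dim_lt[OF convex] assms aff_dim by metis
  moreover have "aff_dim F \<noteq> 2" using assms aff_dim by (auto simp: facet_of_def)
  ultimately show ?thesis by linarith
qed

section \<open>Facet normals and directions parallel to no facet\<close>

definition facet_normal :: "(real^3) set \<Rightarrow> real^3" where
  "facet_normal F = (SOME v. v \<noteq> 0 \<and> max_face P v = F)"

lemma facet_normal:
  assumes "F facet_of P"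
  shows "facet_normal F \<noteq> 0" "max_face P (facet_normal F) = F"
proof -
  have "F face_of P" "F \<noteq> {}" "F \<noteq> P" using assms facet_of_irrefl by (auto simp: facet_of_def)
  then have "\<exists>v. v \<noteq> 0 \<and> max_face P v = F"
    using face_eq_max_face[OF polyhedron] by metis
  from someI_ex[OF this] show "facet_normal F \<noteq> 0" "max_face P (facet_normal F) = F"
    unfolding facet_normal_def by auto
qed

text \<open>The differences of points of the facet span a 2-dimensional space inside the plane
  orthogonal to \<open>v\<close>, hence that whole plane.\<close>

lemma plane_orth_max_face_iff:
  assumes "v \<noteq> 0" "max_face P v facet_of P"
  shows "plane_orth_facet n (max_face P v) \<longleftrightarrow> n \<bullet> v = 0"
proof -
  let ?F = "max_face P v"
  let ?D = "{x - y |x y. x \<in> ?F \<and> y \<in> ?F}"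
  obtain a where a: "a \<in> ?F" using assms by (auto simp: facet_of_def)
  have "int (dim ((\<lambda>x. x - a) ` ?F)) = 2"
    using aff_dim_eq_dim_subtract[of a ?F] a assms aff_dim by (simp add: facet_of_def hull_inc)
  moreover have "(\<lambda>x. x - a) ` ?F \<subseteq> ?D" using a by blast
  ultimately have "2 \<le> dim ?D" using dim_subset[of "(\<lambda>x. x - a) ` ?F" ?D] by linarith
  moreover have "?D \<subseteq> {x. v \<bullet> x = 0}"
    using max_face_eq_Int_hyperplane[OF a] by (auto simp: inner_diff_right)
  then have sub: "span ?D \<subseteq> {x. v \<bullet> x = 0}"
    by (simp add: span_minimal subspace_hyperplane)
  moreover have "dim {x. v \<bullet> x = 0} = 2" using dim_hyperplane[OF assms(1)] by simp
  ultimately have "span ?D = {x. v \<bullet> x = 0}"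
    by (intro subspace_dim_equal) (auto simp: subspace_hyperplane)
  then show ?thesis by (auto simp: plane_orth_facet_def inner_commute)
qed

text \<open>The directions over which \<open>k_equiprojective\<close> quantifies; since
  \<open>P\<close> has a facet, the condition already forces \<open>n \<noteq> 0\<close>.\<close>

definition generic_direction :: "real^3 \<Rightarrow> bool" where
  "generic_direction n \<longleftrightarrow> (\<forall>F. F facet_of P \<longrightarrow> n \<bullet> facet_normal F \<noteq> 0)"

lemma generic_direction_nonzero:
  assumes "generic_direction n" shows "n \<noteq> 0"
proof -
  obtain F where "F facet_of P" using polytope_facet_exists[OF polytope] aff_dim by auto
  then show ?thesis using assms by (auto simp: generic_direction_def)
qed

lemma generic_direction_iff:
  "generic_direction n \<longleftrightarrow> n \<noteq> 0 \<and> (\<forall>F. F facet_of P \<longrightarrow> \<not> plane_orth_facet n F)"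
  using generic_direction_nonzero[of n] plane_orth_max_face_iff[OF facet_normal(1), of _ n] facet_normal
  unfolding generic_direction_def by metis

lemma generic_direction_orth_not_facet:
  assumes "generic_direction n" "r \<noteq> 0" "r \<bullet> n = 0"
  shows "\<not> max_face P r facet_of P"
  using assms plane_orth_max_face_iff[of r n] by (auto simp: generic_direction_iff inner_commute)

section \<open>Edges, their directions and the two facets through them\<close>

lemma edge_segment:
  assumes "G edge_of P"
  obtains a b where "a \<noteq> b" "G = closed_segment a b"
  using assms polytope_aff_dim_1_segment[of G] face_of_polytope_polytope[OF polytope]
  unfolding edge_of_def by blast

lemma edge_eq_Int_facets:
  assumes "G edge_of P"
  obtains F1 F2 where "F1 facet_of P" "F2 facet_of P" "F1 \<noteq> F2" "G = F1 \<inter> F2"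
proof -
  have "G face_of P" "G \<noteq> {}" "aff_dim G = aff_dim P - 2"
    using assms aff_dim by (auto simp: edge_of_def)
  then show ?thesis using ridge_eq_Int_facets[OF polyhedron] that by metis
qed

text \<open>One pair of distinct points suffices: on an edge all differences are then multiples of
  \<open>u\<close>.\<close>

definition edge_parallel :: "(real^3) set \<Rightarrow> real^3 \<Rightarrow> bool" where
  "edge_parallel G u \<longleftrightarrow> (\<exists>a\<in>G. \<exists>b\<in>G. a \<noteq> b \<and> (\<exists>c. a - b = c *\<^sub>R u))"

lemma edge_diff:
  assumes "G edge_of P" "edge_parallel G u" "x \<in> G" "y \<in> G"
  obtains c where "x - y = c *\<^sub>R u"
proof -
  obtain p q where pq: "G = closed_segment p q" using edge_segment assms by metis
  have diff: "\<exists>s. x - y = s *\<^sub>R (q - p)" if xy: "x \<in> G" "y \<in> G" for x y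
  proof -
    obtain s t where "x = (1 - s) *\<^sub>R p + s *\<^sub>R q" "y = (1 - t) *\<^sub>R p + t *\<^sub>R q"
      using xy unfolding pq in_segment by blast
    then have "x - y = (s - t) *\<^sub>R (q - p)" by (simp only:) (simp add: algebra_simps)
    then show ?thesis by blast
  qed
  obtain a b c where ab: "a \<in> G" "b \<in> G" "a \<noteq> b" "a - b = c *\<^sub>R u"
    using assms unfolding edge_parallel_def by blast
  obtain s where s: "a - b = s *\<^sub>R (q - p)" using diff ab by blast
  obtain t where t: "x - y = t *\<^sub>R (q - p)" using diff assms by blast
  have "s \<noteq> 0" using s ab by auto
  then have "q - p = (1 / s) *\<^sub>R (a - b)" using s by simp
  then have "x - y = (t / s * c) *\<^sub>R u" using t ab by simp
  then show ?thesis using that by blast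
qed

lemma edge_inner_const:
  assumes "G edge_of P" "edge_parallel G u" "x \<in> G" "y \<in> G" "r \<bullet> u = 0"
  shows "r \<bullet> x = r \<bullet> y"
proof -
  obtain c where "x - y = c *\<^sub>R u" using edge_diff assms by blast
  then have "r \<bullet> (x - y) = 0" using assms by simp
  then show ?thesis by (simp add: inner_diff_right)
qed

lemma edge_parallel_orth:
  assumes "G \<subseteq> max_face P r" "edge_parallel G u"
  shows "r \<bullet> u = 0"
proof -
  obtain a b c where ab: "a \<in> G" "b \<in> G" "a \<noteq> b" "a - b = c *\<^sub>R u"
    using assms unfolding edge_parallel_def by blast
  then have "c \<noteq> 0" by auto
  have "r \<bullet> a = r \<bullet> b" using ab assms max_face_eq_Int_hyperplane[of b P r] by blast
  then have "r \<bullet> (c *\<^sub>R u) = 0" using ab(4) by (metis inner_diff_right right_minus_eq)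
  with \<open>c \<noteq> 0\<close> show ?thesis by simp
qed

lemma edge_parallel_exists:
  assumes "G edge_of P"
  obtains u where "u \<noteq> 0" "edge_parallel G u"
proof -
  obtain a b where ab: "a \<noteq> b" "G = closed_segment a b" using edge_segment assms by blast
  have "edge_parallel G (a - b)"
    unfolding edge_parallel_def using ab
    by (intro bexI[of _ a] bexI[of _ b] conjI exI[of _ 1]) auto
  then show ?thesis using that[of "a - b"] ab by simp
qed

text \<open>Positively proportional normals expose the same facet, negatively proportional ones
  expose disjoint facets.\<close>

lemma facet_normals_independent:
  assumes "F1 facet_of P" "F2 facet_of P" "F1 \<noteq> F2" "F1 \<inter> F2 \<noteq> {}"
  shows "facet_normal F1 \<times> facet_normal F2 \<noteq> 0"
proof
  assume "facet_normal F1 \<times> facet_normal F2 = 0"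
  then obtain c where c: "facet_normal F2 = c *\<^sub>R facet_normal F1"
    using cross_eq_0_parallel facet_normal assms by blast
  then have "c \<noteq> 0" using facet_normal assms by force
  then consider "c > 0" | "c < 0" by linarith
  then show False
  proof cases
    case 1
    then show False using c max_face_scaleR[of c P "facet_normal F1"] facet_normal assms by metis
  next
    case 2
    then have "max_face P (facet_normal F2) = max_face P (- facet_normal F1)"
      using c max_face_scaleR[of "- c" P "- facet_normal F1"] by simp
    then show False using max_face_opposite[of "facet_normal F1"] facet_normal assms by metis
  qed
qed

text \<open>Both \<open>u\<close> and the direction of \<open>G\<close> are orthogonal to the two
  independent facet normals, so both are multiples of their cross product.\<close>

lemma edge_parallel_if_orth_facets:
  assumes G: "G edge_of P" "F1 facet_of P" "F2 facet_of P" "F1 \<noteq> F2" "G = F1 \<inter> F2"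
    and u: "u \<noteq> 0" "u \<bullet> facet_normal F1 = 0" "u \<bullet> facet_normal F2 = 0"
  shows "edge_parallel G u"
proof -
  obtain a b where ab: "a \<noteq> b" "G = closed_segment a b" using edge_segment G by blast
  then have ne: "F1 \<inter> F2 \<noteq> {}" using G by auto
  have "edge_parallel G (a - b)"
    unfolding edge_parallel_def using ab
    by (intro bexI[of _ a] bexI[of _ b] conjI exI[of _ 1]) auto
  then have "facet_normal F1 \<bullet> (a - b) = 0" "facet_normal F2 \<bullet> (a - b) = 0"
    using edge_parallel_orth[of G] facet_normal G by auto
  then obtain c where c: "a - b = c *\<^sub>R (facet_normal F1 \<times> facet_normal F2)"
    using orthogonal_two_parallel_cross[of "facet_normal F1" "facet_normal F2" "a - b"] facet_normals_independent G ne
    by (metis inner_commute)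
  obtain d where d: "u = d *\<^sub>R (facet_normal F1 \<times> facet_normal F2)"
    using orthogonal_two_parallel_cross[of "facet_normal F1" "facet_normal F2" u] facet_normals_independent G ne u by metis
  then have "d \<noteq> 0" using u by auto
  then have "a - b = (c / d) *\<^sub>R u" using c d by simp
  then show ?thesis unfolding edge_parallel_def using ab by (metis ends_in_segment)
qed

text \<open>A functional \<open>r\<close> with \<open>r \<bullet> n = 0\<close> takes equal values
  at a point and at its projection along \<open>n\<close>, so these are the edges of
  \<open>P\<close> that such functionals can single out after projection.\<close>

definition silhouette :: "real^3 \<Rightarrow> (real^3) set set" where
  "silhouette n = {G. G edge_of P \<and> (\<exists>r. r \<noteq> 0 \<and> r \<bullet> n = 0 \<and> max_face P r = G)}"

text \<open>The functionals exposing \<open>G\<close> are the combinations of the two facet normals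
  with positive coefficients. Such a combination can be orthogonal to \<open>n\<close> exactly when
  \<open>n\<close> has values of opposite sign on the two normals.\<close>

lemma mem_silhouette_iff:
  assumes n: "generic_direction n"
    and G: "G edge_of P" "F1 facet_of P" "F2 facet_of P" "F1 \<noteq> F2" "G = F1 \<inter> F2"
  shows "G \<in> silhouette n \<longleftrightarrow> (n \<bullet> facet_normal F1) * (n \<bullet> facet_normal F2) < 0"
proof -
  let ?a = "facet_normal F1" and ?b = "facet_normal F2"
  have F: "max_face P ?a = F1" "max_face P ?b = F2" using facet_normal G by auto
  have ne: "F1 \<inter> F2 \<noteq> {}" using G by (auto simp: edge_of_def)
  have indep: "?a \<times> ?b \<noteq> 0" using facet_normals_independent G ne by blast
  have nz: "n \<bullet> ?a \<noteq> 0" "n \<bullet> ?b \<noteq> 0" using n G by (auto simp: generic_direction_def)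
  obtain u where u: "u \<noteq> 0" "edge_parallel G u" using edge_parallel_exists G by blast
  have orth: "?a \<bullet> u = 0" "?b \<bullet> u = 0"
    using edge_parallel_orth[of G _ u] u G F by auto
  show ?thesis
  proof
    assume "G \<in> silhouette n"
    then obtain r where r: "r \<noteq> 0" "r \<bullet> n = 0" "max_face P r = G"
      by (auto simp: silhouette_def)
    have "r \<bullet> u = 0" using edge_parallel_orth[of G r u] r u by simp
    then obtain \<alpha> \<beta> where ab: "r = \<alpha> *\<^sub>R ?a + \<beta> *\<^sub>R ?b"
      using orthogonal_in_span_two[of ?a ?b u r] indep u orth by metis
    obtain y where y: "y \<in> F1" "y \<in> F2" using ne by blast
    \<comment> \<open>Moving from \<open>y\<close> to a point of \<open>F1\<close> outside
      \<open>F2\<close> lowers \<open>r\<close> and the normal of \<open>F2\<close> but not the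
      normal of \<open>F1\<close>, so \<open>\<beta>\<close> is positive. The facets and
      coefficients are kept as variables so that swapping the roles also yields
      \<open>\<alpha> > 0\<close>.\<close>
    have coeff: "\<beta> > 0" if "r = \<alpha> *\<^sub>R facet_normal F1 + \<beta> *\<^sub>R facet_normal F2" "F1 facet_of P" "F2 facet_of P"
      "F1 \<noteq> F2" "G = F1 \<inter> F2" "y \<in> F1" "y \<in> F2" for \<alpha> \<beta> F1 F2
    proof -
      have "\<not> F1 \<subseteq> F2"
        using face_of_eq_if_aff_dim_ge[of F1 P F2] that by (auto simp: facet_of_def)
      then obtain x where x: "x \<in> F1" "x \<notin> F2" by blast
      then have xP: "x \<in> P" using that facet_of_imp_subset by blast
      have "r \<bullet> x < r \<bullet> y"
        using r(3) x xP that max_face_eq_Int_hyperplane[of y P r] unfolding max_face_def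
        by (smt (verit) IntE IntI mem_Collect_eq)
      moreover have "facet_normal F2 \<bullet> x < facet_normal F2 \<bullet> y"
        using facet_normal(2)[of F2] x xP that max_face_eq_Int_hyperplane[of y P "facet_normal F2"]
        unfolding max_face_def by (smt (verit) IntE IntI mem_Collect_eq)
      moreover have "facet_normal F1 \<bullet> x = facet_normal F1 \<bullet> y"
        using facet_normal(2)[of F1] x that max_face_eq_Int_hyperplane[of y P "facet_normal F1"] by blast
      ultimately have "\<beta> * (facet_normal F2 \<bullet> x) < \<beta> * (facet_normal F2 \<bullet> y)"
        using that(1) by (simp add: inner_add_left)
      with \<open>facet_normal F2 \<bullet> x < facet_normal F2 \<bullet> y\<close> show "\<beta> > 0"
        by (smt (verit) mult_left_mono_neg)
    qed
    have "\<beta> > 0" using coeff[OF ab G(2,3,4,5)] y by blast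
    moreover have "\<alpha> > 0"
      using coeff[of \<beta> F2 \<alpha> F1] ab G y by (simp add: add.commute Int_commute)
    moreover have "\<alpha> * (n \<bullet> ?a) + \<beta> * (n \<bullet> ?b) = 0"
      using r(2) unfolding ab by (simp add: inner_add_left inner_commute[of n])
    ultimately show "(n \<bullet> ?a) * (n \<bullet> ?b) < 0"
      using nz by (smt (verit, best) mult_less_0_iff zero_less_mult_iff)
  next
    assume neg: "(n \<bullet> ?a) * (n \<bullet> ?b) < 0"
    \<comment> \<open>Weighting each normal by the absolute value of \<open>n\<close> on the other
      makes the two contributions to \<open>r \<bullet> n\<close> cancel.\<close>
    define r where "r = \<bar>n \<bullet> ?b\<bar> *\<^sub>R ?a + \<bar>n \<bullet> ?a\<bar> *\<^sub>R ?b"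
    have pos: "\<bar>n \<bullet> ?b\<bar> > 0" "\<bar>n \<bullet> ?a\<bar> > 0" using nz by auto
    have "r \<bullet> n = \<bar>n \<bullet> ?b\<bar> * (n \<bullet> ?a) + \<bar>n \<bullet> ?a\<bar> * (n \<bullet> ?b)"
      by (simp add: r_def inner_add_left inner_commute[of n])
    also have "\<dots> = 0" using neg by (auto simp: mult_less_0_iff abs_if)
    finally have rn: "r \<bullet> n = 0" .
    have "max_face P r = F1 \<inter> F2"
      unfolding r_def using pos ne F
      by (subst max_face_add) (auto simp: max_face_scaleR)
    then have rG: "max_face P r = G" using G by simp
    have "r \<noteq> 0"
    proof
      assume "r = 0"
      then have "G = P" using rG by (auto simp: max_face_def)
      then show False using G aff_dim by (auto simp: edge_of_def)
    qed
    then show "G \<in> silhouette n" using rn rG G by (auto simp: silhouette_def)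
  qed
qed

text \<open>The projection is a polygon, so its vertices may be replaced by its edges, and mapping
  \<open>G\<close> to its image is a bijection from the silhouette onto these edges.\<close>

lemma card_vertices_eq_card_silhouette:
  assumes n: "generic_direction n"
  shows "card {v. v extreme_point_of (proj_along n ` P)} = card (silhouette n)"
proof -
  let ?q = "proj_along n"
  define Q where "Q = ?q ` P"
  have n0: "n \<noteq> 0" using generic_direction_nonzero n by blast
  have Q: "polytope Q" unfolding Q_def using polytope_linear_image linear_proj_along polytope by blast
  have "affine hull P = UNIV" using aff_dim aff_dim_eq_full[of P] by simp
  then have "affine hull Q = ?q ` UNIV"
    unfolding Q_def
    using affine_hull_linear_image[of ?q P] linear_proj_along linear_conv_bounded_linear by metis
  also have "\<dots> = {x. n \<bullet> x = 0}"
  proof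
    show "range ?q \<subseteq> {x. n \<bullet> x = 0}"
      using proj_along_orthogonal[OF n0] by (auto simp: inner_commute)
    have "x = ?q x" if "n \<bullet> x = 0" for x using that by (simp add: proj_along_def inner_commute)
    then show "{x. n \<bullet> x = 0} \<subseteq> range ?q" by blast
  qed
  finally have "aff_dim Q = 2"
    using aff_dim_affine_hull[of Q] aff_dim_hyperplane[OF n0, of 0] by simp
  have max_Q: "?q ` max_face P r = max_face Q r" if "r \<bullet> n = 0" for r
    using that by (auto simp: max_face_def Q_def proj_along_inner_left)
  have polyQ: "polyhedron Q" using Q polytope_imp_polyhedron by blast
  have "bij_betw ((`) ?q) (silhouette n) {e. e facet_of Q}"
  proof (rule bij_betw_imageI)
    \<comment> \<open>Injectivity: the exposing functional depends only on the projected point, so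
      \<open>G\<close> is recovered as the preimage in \<open>P\<close> of its image.\<close>
    have "G = {x \<in> P. ?q x \<in> ?q ` G}" if G: "G \<in> silhouette n" for G
    proof -
      obtain r where r: "r \<bullet> n = 0" "max_face P r = G" using G by (auto simp: silhouette_def)
      have "x \<in> G" if "x \<in> P" "y \<in> G" "?q x = ?q y" for x y
      proof -
        have "r \<bullet> x = r \<bullet> y" using proj_along_inner_left[OF r(1)] that(3) by metis
        then show ?thesis using that r by (auto simp: max_face_def)
      qed
      then show ?thesis using r max_face_subset by blast
    qed
    then show "inj_on ((`) ?q) (silhouette n)"
      unfolding inj_on_def by metis
    have "?q ` G facet_of Q" if G: "G \<in> silhouette n" for G
    proof -
      obtain r where r: "r \<bullet> n = 0" "max_face P r = G" "G edge_of P"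
        using G by (auto simp: silhouette_def)
      have face: "?q ` G face_of Q"
        using max_Q[OF r(1)] r(2) max_face_face_of polytope_imp_convex[OF Q] by metis
      obtain a b where ab: "a \<noteq> b" "G = closed_segment a b" using edge_segment r by blast
      obtain F1 F2 where F: "F1 facet_of P" "G = F1 \<inter> F2" using edge_eq_Int_facets r by metis
      \<comment> \<open>If the endpoints coincided after projection, \<open>G\<close>, and with it
        the facet \<open>F1\<close>, would be parallel to \<open>n\<close>.\<close>
      have "?q a \<noteq> ?q b"
      proof
        assume eq: "?q a = ?q b"
        then have d: "a - b = ((a \<bullet> n) / (n \<bullet> n) - (b \<bullet> n) / (n \<bullet> n)) *\<^sub>R n" (is "_ = ?c *\<^sub>R n")
          by (simp add: proj_along_def algebra_simps)
        have "facet_normal F1 \<bullet> a = facet_normal F1 \<bullet> b"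
          using max_face_eq_Int_hyperplane[of a P "facet_normal F1"] facet_normal F ab
          by (metis (mono_tags, lifting) IntE ends_in_segment mem_Collect_eq)
        then have "facet_normal F1 \<bullet> (?c *\<^sub>R n) = 0" using d by (metis inner_diff_right right_minus_eq)
        moreover have "?c \<noteq> 0" using d ab by auto
        ultimately show False using n F by (simp add: generic_direction_def inner_commute)
      qed
      moreover have "?q ` G = closed_segment (?q a) (?q b)"
        using ab closed_segment_linear_image[OF linear_proj_along] by metis
      ultimately have "aff_dim (?q ` G) = 1"
        by (simp add: segment_convex_hull aff_dim_convex_hull)
      then show ?thesis using face \<open>aff_dim Q = 2\<close> by (auto simp: facet_of_def)
    qed
    moreover have "e \<in> (`) ?q ` silhouette n" if e: "e facet_of Q" for e
    proof -
      have "e face_of Q" "e \<noteq> {}" "e \<noteq> Q" "aff_dim e = 1"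
        using e facet_of_irrefl \<open>aff_dim Q = 2\<close> by (auto simp: facet_of_def)
      then obtain s where s: "e = max_face Q s" using face_eq_max_face[OF polyQ] by metis
      \<comment> \<open>On \<open>Q\<close>, which is orthogonal to \<open>n\<close>, only the
        component of \<open>s\<close> orthogonal to \<open>n\<close> matters.\<close>
      define r where "r = ?q s"
      have rn: "r \<bullet> n = 0" using proj_along_orthogonal n0 r_def by blast
      have "s \<bullet> y = r \<bullet> y" if "y \<in> Q" for y
        using that proj_along_orthogonal[OF n0] proj_along_inner_left[of y n s] 
        by (auto simp: Q_def r_def inner_commute)
      then have e_r: "e = max_face Q r" unfolding s max_face_def by auto
      have "r \<noteq> 0" using e_r \<open>e \<noteq> Q\<close> by (auto simp: max_face_def)
      let ?G = "max_face P r"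
      have qG: "?q ` ?G = e" using max_Q[OF rn] e_r by simp
      \<comment> \<open>Genericity of \<open>n\<close> rules out a facet, and a vertex is ruled out
        because the image of \<open>?G\<close> is the 1-dimensional \<open>e\<close>.\<close>
      have "aff_dim ?G \<le> 1"
        using face_aff_dim_le_1 max_face_face max_face_neq[OF \<open>r \<noteq> 0\<close>]
          generic_direction_orth_not_facet[OF n \<open>r \<noteq> 0\<close> rn] by blast
      moreover have "1 \<le> aff_dim ?G"
        using aff_dim_linear_image_le[OF linear_proj_along, of n ?G] qG \<open>aff_dim e = 1\<close> by simp
      ultimately have "?G \<in> silhouette n"
        using rn \<open>r \<noteq> 0\<close> max_face_face by (auto simp: silhouette_def edge_of_def)
      then show ?thesis using qG by blast
    qed
    ultimately show "(`) ?q ` silhouette n = {e. e facet_of Q}" by blast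
  qed
  then have "card (silhouette n) = card {e. e facet_of Q}" by (rule bij_betw_same_card)
  also have "\<dots> = card {v. v extreme_point_of Q}"
    using polygon_card_vertices_eq_card_edges[OF Q \<open>aff_dim Q = 2\<close>] by simp
  finally show ?thesis by (simp add: Q_def)
qed

lemma equiprojective_iff:
  "equiprojective P \<longleftrightarrow> (\<exists>k. \<forall>n. generic_direction n \<longrightarrow> card (silhouette n) = k)"
  using card_vertices_eq_card_silhouette
  by (auto simp: equiprojective_def k_equiprojective_def generic_direction_iff[symmetric])

section \<open>Aggregated cones\<close>

lemma normal_cone_eq: "F \<subseteq> P \<Longrightarrow> normal_cone P F = {r. F \<subseteq> max_face P r}"
  by (auto simp: normal_cone_def max_face_def)

text \<open>Each of the finitely many generators in \<open>V\<close> outside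
  \<open>max_face P r\<close> stays strictly below a fixed maximiser \<open>y\<close> under small
  changes of \<open>r\<close>. A face of \<open>P\<close> is the hull of some elements of
  \<open>V\<close>, so none of the excluded ones enters.\<close>

lemma max_face_upper_semicontinuous:
  obtains e where "e > 0" "\<And>s. dist r s < e \<Longrightarrow> max_face P s \<subseteq> max_face P r"
proof -
  obtain V where V: "finite V" "P = convex hull V" using polytope by (auto simp: polytope_def)
  obtain y where y: "y \<in> max_face P r" using max_face_nonempty compact nonempty by blast
  define A where "A = (\<Inter>x\<in>V - max_face P r. {s. s \<bullet> x < s \<bullet> y})"
  have "open A" unfolding A_def using V
    by (intro open_INT) (auto intro!: open_Collect_less continuous_intros)
  moreover have "r \<bullet> x < r \<bullet> y" if "x \<in> V" "x \<notin> max_face P r" for x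
  proof -
    have "x \<in> P" using that V by (simp add: hull_inc)
    then have "r \<bullet> x \<le> r \<bullet> y" "r \<bullet> x \<noteq> r \<bullet> y"
      using y that max_face_eq_Int_hyperplane[OF y] by (auto simp: max_face_def)
    then show ?thesis by simp
  qed
  then have "r \<in> A" by (auto simp: A_def)
  ultimately obtain e where e: "e > 0" "ball r e \<subseteq> A" using open_contains_ball by blast
  have "max_face P s \<subseteq> max_face P r" if s: "dist r s < e" for s
  proof -
    have "s \<in> A" using e s by auto
    have "max_face P s face_of convex hull V" using max_face_face V by simp
    then obtain S where S: "S \<subseteq> V" "max_face P s = convex hull S"
      using face_of_convex_hull_subset[of V] V finite_imp_compact by metis
    have "x \<in> max_face P r" if "x \<in> S" for x
    proof (rule ccontr)
      assume "x \<notin> max_face P r"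
      then have "s \<bullet> x < s \<bullet> y" using \<open>s \<in> A\<close> that S by (auto simp: A_def)
      moreover have "x \<in> max_face P s" using that S by (simp add: hull_inc)
      ultimately show False using y by (force simp: max_face_def)
    qed
    then show ?thesis
      unfolding S(2) using max_face_face face_of_imp_convex by (intro hull_minimal) auto
  qed
  with e that show ?thesis by blast
qed

text \<open>Both vectors have the direction plane of the facet as their orthogonal
  complement.\<close>

lemma facet_normals_parallel:
  assumes "r \<noteq> 0" "s \<noteq> 0" "max_face P r = max_face P s" "max_face P s facet_of P"
  obtains c where "r = c *\<^sub>R s"
proof -
  have iff: "n \<bullet> r = 0 \<longleftrightarrow> n \<bullet> s = 0" for n
    using plane_orth_max_face_iff[of r n] plane_orth_max_face_iff[of s n] assms by simp
  \<comment> \<open>A multiple of the component of \<open>r\<close> orthogonal to \<open>s\<close>;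
    being orthogonal to both \<open>s\<close> and \<open>r\<close>, it is orthogonal to
    itself.\<close>
  define w where "w = (s \<bullet> s) *\<^sub>R r - (s \<bullet> r) *\<^sub>R s"
  have "w \<bullet> s = 0" by (simp add: w_def inner_diff_left inner_commute[of s r])
  moreover from this have "w \<bullet> r = 0" using iff by simp
  ultimately have "w \<bullet> ((s \<bullet> s) *\<^sub>R r - (s \<bullet> r) *\<^sub>R s) = 0" by (simp add: inner_diff_right)
  then have "w \<bullet> w = 0" by (simp add: w_def[symmetric])
  then have eq: "(s \<bullet> s) *\<^sub>R r = (s \<bullet> r) *\<^sub>R s" by (simp add: w_def)
  have "r = (1 / (s \<bullet> s)) *\<^sub>R ((s \<bullet> s) *\<^sub>R r)" using assms(2) by simp
  then have "r = ((s \<bullet> r) / (s \<bullet> s)) *\<^sub>R s" unfolding eq by simp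
  then show ?thesis using that by blast
qed

lemma edge_facet_normals:
  assumes "G edge_of P" "F1 facet_of P" "F2 facet_of P" "F1 \<noteq> F2" "G = F1 \<inter> F2"
  shows "facet_normal F1 \<in> normal_cone P G" "facet_normal F2 \<in> normal_cone P G" "facet_normal F1 \<times> facet_normal F2 \<noteq> 0"
proof -
  have "F1 \<inter> F2 \<noteq> {}" using assms by (metis aff_dim_empty_eq edge_of_def one_neq_neg_one)
  then show "facet_normal F1 \<times> facet_normal F2 \<noteq> 0" using assms facet_normals_independent by blast
  show "facet_normal F1 \<in> normal_cone P G" "facet_normal F2 \<in> normal_cone P G"
    using assms facet_normal normal_cone_eq[OF edge_of_imp_subset[OF assms(1)]] by auto
qed

lemma normal_cone_edge_subset_iff:
  assumes "G edge_of P" "u \<noteq> 0"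
  shows "normal_cone P G \<subseteq> {x. x \<bullet> u = 0} \<longleftrightarrow> edge_parallel G u"
proof
  assume sub: "normal_cone P G \<subseteq> {x. x \<bullet> u = 0}"
  obtain F1 F2 where F: "F1 facet_of P" "F2 facet_of P" "F1 \<noteq> F2" "G = F1 \<inter> F2"
    using edge_eq_Int_facets assms by blast
  have "u \<bullet> facet_normal F1 = 0" "u \<bullet> facet_normal F2 = 0"
    using edge_facet_normals[OF assms(1) F] sub by (auto simp: inner_commute)
  then show "edge_parallel G u" using edge_parallel_if_orth_facets[OF assms(1) F] assms by blast
next
  assume "edge_parallel G u"
  then show "normal_cone P G \<subseteq> {x. x \<bullet> u = 0}"
    using normal_cone_eq[OF edge_of_imp_subset[OF assms(1)]] edge_parallel_orth by auto
qed

text \<open>The cone lies in the plane orthogonal to the edge and contains two independent facet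
  normals.\<close>

lemma aff_dim_normal_cone_edge:
  assumes G: "G edge_of P"
  shows "aff_dim (normal_cone P G) = 2"
proof -
  let ?N = "normal_cone P G"
  obtain u where u: "u \<noteq> 0" "edge_parallel G u" using edge_parallel_exists G by blast
  obtain F1 F2 where F: "F1 facet_of P" "F2 facet_of P" "F1 \<noteq> F2" "G = F1 \<inter> F2"
    using edge_eq_Int_facets G by blast
  let ?a = "facet_normal F1" and ?b = "facet_normal F2"
  have ab: "?a \<in> ?N" "?b \<in> ?N" "?a \<times> ?b \<noteq> 0" using edge_facet_normals[OF G F] by auto
  have "0 \<in> ?N" by (simp add: normal_cone_def)
  then have "aff_dim ?N = int (dim ?N)" by (simp add: aff_dim_zero hull_inc)
  moreover have "?N \<subseteq> {x. u \<bullet> x = 0}"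
    using normal_cone_edge_subset_iff[OF G u(1)] u by (auto simp: inner_commute)
  then have "dim ?N \<le> 2" using dim_subset[of ?N "{x. u \<bullet> x = 0}"] dim_hyperplane[OF u(1)] by simp
  moreover have "independent {?a, ?b}"
  proof -
    have "?b \<noteq> 0" using ab by auto
    moreover have "?a \<notin> span {?b}"
      using ab by (auto simp: span_singleton cross_mult_left)
    ultimately show ?thesis by (simp add: independent_insert)
  qed
  moreover have "?a \<noteq> ?b" using ab by auto
  ultimately show ?thesis
    using independent_card_le_dim[of "{?a, ?b}" ?N] ab by simp
qed

text \<open>Every other kind of face gives a cone of another dimension: the whole space for the
  empty face, \<open>{0}\<close> for \<open>P\<close>, part of a line for a facet, and a set
  containing a ball for a vertex, by semicontinuity. Hence only edges contribute to
  \<open>aggregated_cone\<close>.\<close>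

lemma edge_if_aff_dim_normal_cone:
  assumes F: "F face_of P" and N: "aff_dim (normal_cone P F) = 2"
  shows "F edge_of P"
proof -
  have FP: "F \<subseteq> P" using F face_of_imp_subset by blast
  note N_eq = normal_cone_eq[OF FP]
  have 0: "0 \<in> normal_cone P F" by (simp add: normal_cone_def)
  have "F \<noteq> {}"
  proof
    assume "F = {}"
    then have "normal_cone P F = UNIV" by (auto simp: normal_cone_def)
    then show False using N by simp
  qed
  moreover have "F \<noteq> P"
  proof
    assume "F = P"
    then have "normal_cone P F \<subseteq> {0}"
      using N_eq max_face_neq max_face_subset by blast
    then have "aff_dim (normal_cone P F) \<le> aff_dim {0::real^3}" by (rule aff_dim_subset)
    then show False using N by simp
  qed
  moreover have "\<not> F facet_of P"
  proof
    assume facet: "F facet_of P"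
    have "r \<in> span {facet_normal F}" if r: "r \<in> normal_cone P F" for r
    proof (cases "r = 0")
      case False
      have sub: "F \<subseteq> max_face P r" using r N_eq by simp
      have "aff_dim (max_face P r) < 3"
        using face_of_aff_dim_lt[OF convex max_face_face max_face_neq[OF False]] aff_dim by simp
      then have "F = max_face P r"
        using face_of_eq_if_aff_dim_ge[OF F max_face_face sub] facet aff_dim
        by (simp add: facet_of_def)
      then obtain c where "r = c *\<^sub>R facet_normal F"
        using facet_normals_parallel[OF False, of "facet_normal F"] facet_normal[OF facet] facet by metis
      then show ?thesis by (auto simp: span_singleton)
    qed (simp add: span_zero)
    then have "dim (normal_cone P F) \<le> card {facet_normal F}" by (intro dim_le_card) auto
    moreover have "aff_dim (normal_cone P F) = int (dim (normal_cone P F))"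
      using 0 by (simp add: aff_dim_zero hull_inc)
    ultimately show False using N by simp
  qed
  moreover have "aff_dim F \<noteq> 0"
  proof
    assume "aff_dim F = 0"
    then obtain v where v: "F = {v}" using aff_dim_eq_0 by blast
    obtain r where r: "F = max_face P r"
      using face_eq_max_face[OF polyhedron F] \<open>F \<noteq> {}\<close> \<open>F \<noteq> P\<close> by metis
    obtain e where e: "e > 0" "\<And>s. dist r s < e \<Longrightarrow> max_face P s \<subseteq> max_face P r"
      using max_face_upper_semicontinuous by blast
    have "ball r e \<subseteq> normal_cone P F"
    proof
      fix s assume "s \<in> ball r e"
      then have "max_face P s \<subseteq> {v}" using e r v by auto
      then have "max_face P s = {v}" using max_face_nonempty[OF compact nonempty] by blast
      then show "s \<in> normal_cone P F" using N_eq v by simp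
    qed
    then have "aff_dim (ball r e) \<le> aff_dim (normal_cone P F)" by (rule aff_dim_subset)
    moreover have "aff_dim (ball r e) = 3" using e aff_dim_open[of "ball r e"] by simp
    ultimately show False using N by simp
  qed
  moreover have "aff_dim F \<noteq> -1" using aff_dim_empty[of F] \<open>F \<noteq> {}\<close> by blast
  ultimately show ?thesis
    using face_aff_dim_le_1[OF F] aff_dim_geq[of F] F unfolding edge_of_def by auto
qed

section \<open>Aggregated cones as unions over parallel edges\<close>

lemma aggregated_cone_eq:
  assumes "u \<noteq> 0"
  shows "aggregated_cone P u = \<Union>(normal_cone P ` {G. G edge_of P \<and> edge_parallel G u})"
proof -
  have "F face_of P \<and> aff_dim (normal_cone P F) = 2 \<and> normal_cone P F \<subseteq> {x. x \<bullet> u = 0}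
     \<longleftrightarrow> F edge_of P \<and> edge_parallel F u" for F
    using aff_dim_normal_cone_edge edge_if_aff_dim_normal_cone normal_cone_edge_subset_iff assms
    unfolding edge_of_def by blast
  then show ?thesis unfolding aggregated_cone_def by blast
qed

lemma mem_aggregated_cone_iff:
  assumes "u \<noteq> 0"
  shows "r \<in> aggregated_cone P u \<longleftrightarrow> (\<exists>G. G edge_of P \<and> edge_parallel G u \<and> G \<subseteq> max_face P r)"
proof -
  have "r \<in> normal_cone P G \<longleftrightarrow> G \<subseteq> max_face P r" if "G edge_of P" for G
    using normal_cone_eq[OF edge_of_imp_subset[OF that]] by simp
  then show ?thesis unfolding aggregated_cone_eq[OF assms] by blast
qed

lemma aggregated_cone_scaleR:
  assumes "u \<noteq> 0" "c > 0"
  shows "c *\<^sub>R r \<in> aggregated_cone P u \<longleftrightarrow> r \<in> aggregated_cone P u"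
  using assms by (simp add: mem_aggregated_cone_iff max_face_scaleR)

lemma aggregated_cone_subset:
  assumes "u \<noteq> 0"
  shows "aggregated_cone P u \<subseteq> {x. x \<bullet> u = 0}"
  using mem_aggregated_cone_iff[OF assms] edge_parallel_orth by auto

lemma finite_edges: "finite {G. G edge_of P}"
  using finite_polytope_faces[OF polytope] by (rule rev_finite_subset) (auto simp: edge_of_def)

lemma closed_aggregated_cone:
  assumes "u \<noteq> 0"
  shows "closed (aggregated_cone P u)"
proof -
  have "closed (normal_cone P G)" for G
  proof -
    have "normal_cone P G = (\<Inter>x\<in>P. \<Inter>y\<in>G. {r. r \<bullet> x \<le> r \<bullet> y})"
      by (auto simp: normal_cone_def)
    then show ?thesis by (auto intro!: closed_INT closed_Collect_le continuous_intros)
  qed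
  moreover have "finite {G. G edge_of P \<and> edge_parallel G u}" using finite_edges by simp
  ultimately show ?thesis
    unfolding aggregated_cone_eq[OF assms] by (intro closed_Union) auto
qed

text \<open>The cone contains two independent facet normals, so the relative interior in condition
  (ii) is the interior within the plane orthogonal to \<open>u\<close>.\<close>

lemma affine_hull_uminus_aggregated_cone:
  assumes u: "u \<noteq> 0" and G: "G edge_of P" "edge_parallel G u"
  shows "affine hull (uminus ` aggregated_cone P u) = {x. x \<bullet> u = 0}"
proof
  let ?C = "aggregated_cone P u"
  have "uminus ` ?C \<subseteq> {x. u \<bullet> x = 0}" using aggregated_cone_subset[OF u] by (auto simp: inner_commute)
  then have "affine hull (uminus ` ?C) \<subseteq> {x. u \<bullet> x = 0}"
    by (simp add: hull_minimal affine_hyperplane)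
  then show "affine hull (uminus ` ?C) \<subseteq> {x. x \<bullet> u = 0}" by (auto simp: inner_commute)
  have N: "normal_cone P G \<subseteq> ?C" using aggregated_cone_eq[OF u] G by blast
  moreover have "0 \<in> normal_cone P G" by (simp add: normal_cone_def)
  ultimately have "0 \<in> ?C" by blast
  then have "0 \<in> uminus ` ?C" by (metis image_eqI minus_zero)
  then have hull: "affine hull (uminus ` ?C) = span (uminus ` ?C)"
    by (simp add: affine_hull_span_0 hull_inc)
  obtain F1 F2 where F: "F1 facet_of P" "F2 facet_of P" "F1 \<noteq> F2" "G = F1 \<inter> F2"
    using edge_eq_Int_facets G by blast
  have in_C: "facet_normal F1 \<in> ?C" "facet_normal F2 \<in> ?C" and indep: "facet_normal F1 \<times> facet_normal F2 \<noteq> 0"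
    using N edge_facet_normals[OF G(1) F] by auto
  have orth: "facet_normal F1 \<bullet> u = 0" "facet_normal F2 \<bullet> u = 0" using in_C aggregated_cone_subset[OF u] by auto
  show "{x. x \<bullet> u = 0} \<subseteq> affine hull (uminus ` ?C)"
  proof
    fix x assume "x \<in> {x. x \<bullet> u = 0}"
    then obtain \<alpha> \<beta> where "x = \<alpha> *\<^sub>R facet_normal F1 + \<beta> *\<^sub>R facet_normal F2"
      using orthogonal_in_span_two[OF indep u orth] by blast
    then have "x = (- \<alpha>) *\<^sub>R (- facet_normal F1) + (- \<beta>) *\<^sub>R (- facet_normal F2)" by simp
    moreover have "- facet_normal F1 \<in> span (uminus ` ?C)" "- facet_normal F2 \<in> span (uminus ` ?C)"
      using in_C by (auto intro: span_base)
    ultimately show "x \<in> affine hull (uminus ` ?C)"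
      unfolding hull by (metis span_add span_mul)
  qed
qed

text \<open>A nearby \<open>s\<close> is maximised within the edge exposed by \<open>r\<close>; if
  \<open>s\<close> is orthogonal to \<open>u\<close> it is constant on that edge, hence maximal on
  all of it.\<close>

lemma aggregated_cone_nbhd:
  assumes u: "u \<noteq> 0" and r: "max_face P r edge_of P" "edge_parallel (max_face P r) u"
  obtains e where "e > 0" "ball r e \<inter> {x. x \<bullet> u = 0} \<subseteq> aggregated_cone P u"
proof -
  obtain e where e: "e > 0" "\<And>s. dist r s < e \<Longrightarrow> max_face P s \<subseteq> max_face P r"
    using max_face_upper_semicontinuous by blast
  have "s \<in> aggregated_cone P u" if s: "dist r s < e" "s \<bullet> u = 0" for s
  proof -
    obtain y where y: "y \<in> max_face P s" using max_face_nonempty[OF compact nonempty] by blast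
    have "x \<in> max_face P s" if x: "x \<in> max_face P r" for x
    proof -
      have "s \<bullet> x = s \<bullet> y" using edge_inner_const[OF r x _ s(2)] e(2)[OF s(1)] y by blast
      then show ?thesis using y x max_face_subset by (auto simp: max_face_def)
    qed
    then show ?thesis unfolding mem_aggregated_cone_iff[OF u] using r by blast
  qed
  then have "ball r e \<inter> {x. x \<bullet> u = 0} \<subseteq> aggregated_cone P u" by auto
  then show ?thesis using that e by blast
qed

section \<open>Generic vectors of the plane orthogonal to \<open>u\<close>\<close>

text \<open>For \<open>u \<noteq> 0\<close> this says that \<open>r\<close> is not a multiple of any
  facet normal orthogonal to \<open>u\<close>. The form with \<open>r \<times> u\<close> is what
  makes \<open>u\<close> perturbed by small non-zero multiples of \<open>r \<times> u\<close> a
  generic direction.\<close>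

definition generic_in_plane :: "real^3 \<Rightarrow> real^3 \<Rightarrow> bool" where
  "generic_in_plane u r \<longleftrightarrow> r \<bullet> u = 0 \<and> (\<forall>F. F facet_of P \<longrightarrow> u \<bullet> facet_normal F = 0 \<longrightarrow> (r \<times> u) \<bullet> facet_normal F \<noteq> 0)"

lemma generic_in_plane_uminus: "generic_in_plane u r \<Longrightarrow> generic_in_plane u (- r)"
  by (simp add: generic_in_plane_def)

text \<open>Against a normal orthogonal to \<open>u\<close>, only the \<open>n\<close> term of
  \<open>(u \<times> n) \<times> u\<close> survives.\<close>

lemma generic_in_plane_cross:
  assumes "generic_direction n" "u \<noteq> 0"
  shows "generic_in_plane u (u \<times> n)"
proof -
  have "(u \<times> n) \<times> u = (u \<bullet> u) *\<^sub>R n - (u \<bullet> n) *\<^sub>R u"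
    using Lagrange[of u u n] cross_skew[of "u \<times> n" u] by simp
  then show ?thesis
    using assms by (auto simp: generic_in_plane_def generic_direction_def dot_cross_self inner_diff_left)
qed

lemma generic_in_plane_nonzero:
  assumes G: "G edge_of P" "edge_parallel G u" and r: "generic_in_plane u r"
  shows "r \<noteq> 0"
proof -
  obtain F1 F2 where F: "F1 facet_of P" "F2 facet_of P" "F1 \<noteq> F2" "G = F1 \<inter> F2"
    using edge_eq_Int_facets G by blast
  have "facet_normal F1 \<bullet> u = 0" using edge_parallel_orth[of G "facet_normal F1" u] G F facet_normal by auto
  then show ?thesis using r F by (auto simp: generic_in_plane_def inner_commute)
qed

lemma generic_in_plane_not_facet:
  assumes r: "generic_in_plane u r" "r \<noteq> 0"
  shows "\<not> max_face P r facet_of P"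
proof
  assume F: "max_face P r facet_of P"
  let ?F = "max_face P r"
  obtain c where c: "facet_normal ?F = c *\<^sub>R r"
    using facet_normals_parallel[of "facet_normal ?F" r] facet_normal[OF F] F r by metis
  then have "u \<bullet> facet_normal ?F = 0" using r by (simp add: generic_in_plane_def inner_commute)
  moreover have "(r \<times> u) \<bullet> facet_normal ?F = 0" using c by (simp add: dot_cross_self inner_commute)
  ultimately show False using r F by (auto simp: generic_in_plane_def)
qed

text \<open>The exposed face contains an edge parallel to \<open>u\<close> and, by genericity, is
  not a facet, so it is that edge.\<close>

lemma generic_in_plane_max_face:
  assumes u: "u \<noteq> 0" and r: "generic_in_plane u r" "r \<noteq> 0" "r \<in> aggregated_cone P u"
  shows "max_face P r edge_of P" "edge_parallel (max_face P r) u"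
proof -
  obtain G where G: "G edge_of P" "edge_parallel G u" "G \<subseteq> max_face P r"
    using r mem_aggregated_cone_iff[OF u] by blast
  have "aff_dim (max_face P r) \<le> 1"
    using face_aff_dim_le_1[OF max_face_face max_face_neq generic_in_plane_not_facet] r by blast
  then have "G = max_face P r"
    using face_of_eq_if_aff_dim_ge[OF _ max_face_face G(3)] G by (simp add: edge_of_def)
  with G show "max_face P r edge_of P" "edge_parallel (max_face P r) u" by auto
qed

text \<open>A functional exposing such an edge is orthogonal to both \<open>u\<close> and
  \<open>n\<close>, so up to a positive factor it is \<open>u \<times> n\<close> or its negative.
  These two expose disjoint faces, and each counts exactly when it belongs to the aggregated
  cone.\<close>

lemma card_silhouette_par:
  assumes u: "u \<noteq> 0" and G: "G edge_of P" "edge_parallel G u"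
    and gen: "generic_in_plane u (u \<times> n)"
  shows "card {G \<in> silhouette n. edge_parallel G u} =
    of_bool (u \<times> n \<in> aggregated_cone P u) + of_bool (- (u \<times> n) \<in> aggregated_cone P u)"
proof -
  let ?C = "aggregated_cone P u"
  define r where "r = u \<times> n"
  have r0: "r \<noteq> 0" using generic_in_plane_nonzero[OF G gen] r_def by simp
  have gen': "generic_in_plane u r" "generic_in_plane u (- r)"
    using gen generic_in_plane_uminus r_def by auto
  have "{G \<in> silhouette n. edge_parallel G u} =
    (if r \<in> ?C then {max_face P r} else {}) \<union> (if - r \<in> ?C then {max_face P (- r)} else {})"
    (is "?L = ?R")
  proof
    show "?L \<subseteq> ?R"
    proof
      fix G assume "G \<in> ?L"
      then obtain s where s: "G edge_of P" "edge_parallel G u" "s \<noteq> 0" "s \<bullet> n = 0" "max_face P s = G"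
        by (auto simp: silhouette_def)
      then have "s \<bullet> u = 0" using edge_parallel_orth[of G s u] by simp
      then obtain c where c: "s = c *\<^sub>R r"
        using orthogonal_two_parallel_cross[of u n s] s r0 r_def by metis
      then consider "c > 0" | "c < 0" using s by fastforce
      then show "G \<in> ?R"
      proof cases
        case 1
        then have "max_face P r = G" using s c max_face_scaleR by metis
        moreover from this have "r \<in> ?C" using s mem_aggregated_cone_iff[OF u] by blast
        ultimately show ?thesis by simp
      next
        case 2
        then have "max_face P (- r) = G" using s c max_face_scaleR[of "- c" P "- r"] by simp
        moreover from this have "- r \<in> ?C" using s mem_aggregated_cone_iff[OF u] by blast
        ultimately show ?thesis by simp
      qed
    qed
    have "r \<bullet> n = 0" by (simp add: r_def dot_cross_self)
    then show "?R \<subseteq> ?L"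
      using generic_in_plane_max_face[OF u gen'(1) r0] generic_in_plane_max_face[OF u gen'(2)] r0
      by (auto simp: silhouette_def intro: exI[of _ r] exI[of _ "- r"])
  qed
  moreover have "max_face P r \<noteq> max_face P (- r)"
    using max_face_opposite[OF r0] max_face_nonempty[OF compact nonempty] by (metis Int_absorb)
  ultimately show ?thesis unfolding r_def[symmetric] by simp
qed

lemma generic_in_plane_dense:
  assumes u: "u \<noteq> 0" and G: "G edge_of P" "edge_parallel G u" and x: "x \<bullet> u = 0" and e: "e > 0"
  obtains y where "generic_in_plane u y" "dist x y < e"
proof -
  obtain F1 F2 where F: "F1 facet_of P" "F2 facet_of P" "F1 \<noteq> F2" "G = F1 \<inter> F2"
    using edge_eq_Int_facets G by blast
  define p q where "p = facet_normal F1" and "q = facet_normal F2"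
  have indep: "p \<times> q \<noteq> 0" using edge_facet_normals[OF G(1) F] by (simp add: p_def q_def)
  have orth: "p \<bullet> u = 0" "q \<bullet> u = 0"
    using edge_parallel_orth[of G _ u] G F facet_normal by (auto simp: p_def q_def)
  \<comment> \<open>A curve through \<open>x\<close> in the plane. As \<open>p\<close> and
    \<open>q\<close> span the plane, each genericity condition along it fails only at the roots of a
    non-constant polynomial in \<open>t\<close> of degree at most 2, so all conditions hold for
    small \<open>t \<noteq> 0\<close>.\<close>
  define y where "y t = x + t *\<^sub>R p + t\<^sup>2 *\<^sub>R q" for t
  have y_orth: "y t \<bullet> u = 0" for t using x orth by (simp add: y_def inner_add_left)
  have "\<forall>\<^sub>F t in at 0. (y t \<times> u) \<bullet> facet_normal F \<noteq> 0" if F: "F facet_of P" "u \<bullet> facet_normal F = 0" for F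
  proof -
    define w where "w = u \<times> facet_normal F"
    have "w \<noteq> 0"
    proof
      assume "w = 0"
      then obtain c where "facet_normal F = c *\<^sub>R u" using cross_eq_0_parallel u w_def by metis
      then show False using F facet_normal u by auto
    qed
    have "w \<bullet> u = 0" by (simp add: w_def dot_cross_self)
    then obtain \<alpha> \<beta> where w: "w = \<alpha> *\<^sub>R p + \<beta> *\<^sub>R q"
      using orthogonal_in_span_two[OF indep u orth] by blast
    have "p \<bullet> w \<noteq> 0 \<or> q \<bullet> w \<noteq> 0"
    proof (rule ccontr)
      assume "\<not> ?thesis"
      then have "w \<bullet> w = 0" using w by (metis inner_add_left inner_scaleR_left mult_zero_right add_0)
      then show False using \<open>w \<noteq> 0\<close> by simp
    qed
    then have "finite {t. x \<bullet> w + t * (p \<bullet> w) + t\<^sup>2 * (q \<bullet> w) = 0}"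
      by (rule finite_quadratic_roots)
    moreover have "(y t \<times> u) \<bullet> facet_normal F = x \<bullet> w + t * (p \<bullet> w) + t\<^sup>2 * (q \<bullet> w)" for t
    proof -
      have "(y t \<times> u) \<bullet> facet_normal F = y t \<bullet> w" unfolding w_def by (metis cross_triple inner_commute)
      then show ?thesis by (simp add: y_def inner_add_left)
    qed
    ultimately have "\<not> 0 islimpt {t. (y t \<times> u) \<bullet> facet_normal F = 0}" by (simp add: islimpt_finite)
    then show ?thesis by (simp add: islimpt_iff_eventually)
  qed
  then have "\<forall>\<^sub>F t in at 0. \<forall>F\<in>{F. F facet_of P}. u \<bullet> facet_normal F = 0 \<longrightarrow> (y t \<times> u) \<bullet> facet_normal F \<noteq> 0"
    using finite_polytope_facets[OF polytope]
    by (intro eventually_ball_finite) (auto simp: eventually_mono)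
  moreover have "(y \<longlongrightarrow> y 0) (at 0)" unfolding y_def by (intro tendsto_intros)
  then have "\<forall>\<^sub>F t in at 0. dist (y t) x < e" using tendstoD[OF _ e] by (force simp: y_def)
  ultimately have "\<forall>\<^sub>F t in at (0::real). generic_in_plane u (y t) \<and> dist x (y t) < e"
    by eventually_elim (auto simp: generic_in_plane_def y_orth dist_commute)
  then obtain t where "generic_in_plane u (y t) \<and> dist x (y t) < e"
    using eventually_happens'[of "at (0::real)"] by auto
  then show ?thesis using that by blast
qed

text \<open>Density in the plane is not enough, as \<open>x\<close> may lie on the boundary of the
  cone. It is first pushed along the sum of the two facet normals of an edge \<open>G\<close>
  exposed within \<open>max_face P x\<close>; the new point exposes exactly \<open>G\<close>, so a
  neighbourhood of it in the plane lies in the cone.\<close>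

lemma aggregated_cone_gen_dense:
  assumes u: "u \<noteq> 0" and x: "x \<in> aggregated_cone P u" and e: "e > 0"
  obtains y where "generic_in_plane u y" "y \<in> aggregated_cone P u" "dist x y < e"
proof -
  obtain G where G: "G edge_of P" "edge_parallel G u" "G \<subseteq> max_face P x"
    using x mem_aggregated_cone_iff[OF u] by blast
  obtain F1 F2 where F: "F1 facet_of P" "F2 facet_of P" "F1 \<noteq> F2" "G = F1 \<inter> F2"
    using edge_eq_Int_facets G by blast
  have ne: "G \<noteq> {}" using G by (auto simp: edge_of_def)
  define d where "d = facet_normal F1 + facet_normal F2"
  have "max_face P d = G"
    unfolding d_def using max_face_add[of P "facet_normal F1" "facet_normal F2"] facet_normal F ne by simp
  \<comment> \<open>Half of \<open>e\<close> pays for the push, half for the generic approximation;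
    the \<open>+ 1\<close> keeps the denominator positive and the bound strict.\<close>
  define t where "t = e / 2 / (norm d + 1)"
  have "norm d + 1 > 0" by (simp add: add_nonneg_pos)
  then have t: "t > 0" "t * norm d < e / 2"
    using e by (auto simp: t_def field_simps)
  define z where "z = x + t *\<^sub>R d"
  have "max_face P (t *\<^sub>R d) = G" using max_face_scaleR t \<open>max_face P d = G\<close> by metis
  then have z: "max_face P z = G"
    unfolding z_def using max_face_add[of P x "t *\<^sub>R d"] G ne by blast
  obtain e' where e': "e' > 0" "ball z e' \<inter> {x. x \<bullet> u = 0} \<subseteq> aggregated_cone P u"
    using aggregated_cone_nbhd[OF u, of z] G z by blast
  have "z \<bullet> u = 0" using edge_parallel_orth[of G z u] z G by simp
  then obtain y where y: "generic_in_plane u y" "dist z y < min e' (e / 2)"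
    using generic_in_plane_dense[OF u G(1,2), of z "min e' (e / 2)"] e' e by auto
  have "y \<in> aggregated_cone P u" using e' y by (auto simp: generic_in_plane_def)
  moreover have "dist x z < e / 2" using t by (simp add: z_def dist_norm)
  then have "dist x y < e" using y dist_triangle[of x y z] by simp
  ultimately show ?thesis using that y by blast
qed

section \<open>Counting edges by direction\<close>

lemma edge_direction_iff:
  "edge_direction P u \<longleftrightarrow>
    norm u = 1 \<and> first_nonzero_pos u \<and> (\<exists>G. G edge_of P \<and> edge_parallel G u)"
proof -
  have "(\<exists>a b c. a extreme_point_of G \<and> b extreme_point_of G \<and> a \<noteq> b \<and> a - b = c *\<^sub>R u)
      \<longleftrightarrow> edge_parallel G u" (is "?L \<longleftrightarrow> _") if G: "G edge_of P" for G
  proof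
    show "?L \<Longrightarrow> edge_parallel G u" unfolding edge_parallel_def extreme_point_of_def by blast
    assume par: "edge_parallel G u"
    obtain a b where ab: "a \<noteq> b" "G = closed_segment a b" using edge_segment G by blast
    then obtain c where "a - b = c *\<^sub>R u" using edge_diff[OF G par, of a b] by auto
    moreover have "a extreme_point_of G" "b extreme_point_of G"
      using ab extreme_point_of_segment by blast+
    ultimately show ?L using ab by blast
  qed
  then show ?thesis unfolding edge_direction_def by blast
qed

text \<open>Parallel unit vectors agree up to sign, and the sign is fixed by the first non-zero
  coordinate.\<close>

lemma edge_direction_unique:
  assumes G: "G edge_of P" and u: "norm u = 1" "first_nonzero_pos u" "edge_parallel G u"
    and v: "norm v = 1" "first_nonzero_pos v" "edge_parallel G v"
  shows "u = v"
proof -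
  obtain a b c where ab: "a \<in> G" "b \<in> G" "a \<noteq> b" "a - b = c *\<^sub>R u"
    using u unfolding edge_parallel_def by blast
  obtain d where d: "a - b = d *\<^sub>R v" using edge_diff[OF G v(3) ab(1,2)] by blast
  have eq: "c *\<^sub>R u = d *\<^sub>R v" using ab d by simp
  then have "\<bar>c\<bar> = \<bar>d\<bar>" using u v by (metis norm_scaleR mult.right_neutral)
  moreover have "c \<noteq> 0" using ab by auto
  moreover from calculation have "c *\<^sub>R u = c *\<^sub>R v \<or> c *\<^sub>R u = c *\<^sub>R (- v)"
    using eq by (auto simp: abs_eq_iff)
  ultimately have "u = v \<or> u = - v" unfolding scaleR_cancel_left by blast
  moreover have "v \<noteq> 0" using v by auto
  ultimately show ?thesis using first_nonzero_pos_uminus[of v] u v by auto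
qed

lemma edge_direction_exists:
  assumes G: "G edge_of P"
  obtains u where "edge_direction P u" "edge_parallel G u"
proof -
  obtain w where w: "w \<noteq> 0" "edge_parallel G w" using edge_parallel_exists G by blast
  define v where "v = w /\<^sub>R norm w"
  have "w = norm w *\<^sub>R v" using w by (simp add: v_def)
  then have par: "edge_parallel G v" using w(2) unfolding edge_parallel_def by (metis scaleR_scaleR)
  then have par': "edge_parallel G (- v)" unfolding edge_parallel_def by (metis scaleR_minus_left scaleR_minus_right minus_minus)
  have v: "norm v = 1" "v \<noteq> 0" using w by (auto simp: v_def)
  show ?thesis
  proof (cases "first_nonzero_pos v")
    case True
    then show ?thesis using that[of v] par v G by (auto simp: edge_direction_iff)
  next
    case False
    then have "first_nonzero_pos (- v)" using first_nonzero_pos_uminus v by blast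
    then show ?thesis using that[of "- v"] par' v G by (auto simp: edge_direction_iff)
  qed
qed

lemma finite_edge_directions: "finite {u. edge_direction P u}"
proof -
  have "{u. edge_direction P u} =
    (\<Union>G\<in>{G. G edge_of P}. {u. norm u = 1 \<and> first_nonzero_pos u \<and> edge_parallel G u})"
    by (auto simp: edge_direction_iff)
  moreover have "finite {u. norm u = 1 \<and> first_nonzero_pos u \<and> edge_parallel G u}" (is "finite ?S")
    if "G edge_of P" for G
  proof (cases "?S = {}")
    case False
    then obtain u where "u \<in> ?S" by blast
    then have "?S \<subseteq> {u}" using edge_direction_unique[OF that] by blast
    then show ?thesis using finite_subset by blast
  qed (simp only: finite.emptyI)
  ultimately show ?thesis using finite_edges by simp
qed

lemma finite_silhouette: "finite (silhouette n)"
  using finite_edges by (rule rev_finite_subset) (auto simp: silhouette_def)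

text \<open>Each edge is parallel to exactly one edge direction.\<close>

lemma card_silhouette_sum:
  "card (silhouette n) = (\<Sum>u | edge_direction P u. card {G \<in> silhouette n. edge_parallel G u})"
proof -
  have "silhouette n = (\<Union>u\<in>{u. edge_direction P u}. {G \<in> silhouette n. edge_parallel G u})"
  proof -
    have "\<exists>u. edge_direction P u \<and> edge_parallel G u" if "G \<in> silhouette n" for G
      using that edge_direction_exists[of G] by (auto simp: silhouette_def)
    then show ?thesis by blast
  qed
  moreover have "card (\<Union>u\<in>{u. edge_direction P u}. {G \<in> silhouette n. edge_parallel G u}) =
    (\<Sum>u | edge_direction P u. card {G \<in> silhouette n. edge_parallel G u})"
  proof (rule card_UN_disjoint)
    show "finite {u. edge_direction P u}" by (rule finite_edge_directions)
    show "\<forall>u\<in>{u. edge_direction P u}. finite {G \<in> silhouette n. edge_parallel G u}"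
      using finite_silhouette by simp
    have "u = v" if "edge_direction P u" "edge_direction P v" "G \<in> silhouette n"
      "edge_parallel G u" "edge_parallel G v" for u v G
      using that edge_direction_unique[of G u v] by (auto simp: edge_direction_iff silhouette_def)
    then show "\<forall>u\<in>{u. edge_direction P u}. \<forall>v\<in>{u. edge_direction P u}. u \<noteq> v \<longrightarrow>
      {G \<in> silhouette n. edge_parallel G u} \<inter> {G \<in> silhouette n. edge_parallel G v} = {}"
      by blast
  qed
  ultimately show ?thesis by simp
qed

section \<open>Conditions (i) and (ii) in terms of the count at generic vectors\<close>

text \<open>Case (i) is immediate. In case (ii), if \<open>r\<close> and \<open>- r\<close> were
  both in the cone, a neighbourhood of \<open>- r\<close> would be too, putting \<open>r\<close>
  into the relative interior of the negated cone, against disjointness; and if \<open>r\<close> is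
  not in the cone, the covering puts \<open>- r\<close> into it.\<close>

lemma gen_count_if_condition:
  assumes u: "u \<noteq> 0" and G: "G edge_of P" "edge_parallel G u" and r: "generic_in_plane u r"
    and C: "aggregated_cone P u = {x. x \<bullet> u = 0} \<or>
       (aggregated_cone P u \<inter> rel_interior (uminus ` aggregated_cone P u) = {} \<and>
        aggregated_cone P u \<union> rel_interior (uminus ` aggregated_cone P u) = {x. x \<bullet> u = 0})"
  shows "of_bool (r \<in> aggregated_cone P u) + of_bool (- r \<in> aggregated_cone P u) =
    (if aggregated_cone P u = {x. x \<bullet> u = 0} then 2 else 1 :: nat)"
proof -
  let ?C = "aggregated_cone P u"
  have ru: "r \<bullet> u = 0" using r by (simp add: generic_in_plane_def)
  show ?thesis
  proof (cases "?C = {x. x \<bullet> u = 0}")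
    case True
    then show ?thesis using ru by simp
  next
    case False
    then have disj: "?C \<inter> rel_interior (uminus ` ?C) = {}"
      and un: "?C \<union> rel_interior (uminus ` ?C) = {x. x \<bullet> u = 0}" using C by auto
    have "- r \<notin> ?C" if "r \<in> ?C"
    proof
      assume neg: "- r \<in> ?C"
      have "- r \<noteq> 0" using generic_in_plane_nonzero[OF G r] by simp
      then obtain e where e: "e > 0" "ball (- r) e \<inter> {x. x \<bullet> u = 0} \<subseteq> ?C"
        using aggregated_cone_nbhd[OF u] generic_in_plane_max_face[OF u generic_in_plane_uminus[OF r] _ neg]
        by blast
      have "ball r e \<inter> {x. x \<bullet> u = 0} \<subseteq> uminus ` ?C"
      proof
        fix x assume x: "x \<in> ball r e \<inter> {x. x \<bullet> u = 0}"
        then have "- x \<in> ball (- r) e" by (simp add: dist_minus)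
        then have "- x \<in> ?C" using e x by auto
        then show "x \<in> uminus ` ?C" by (metis image_eqI minus_minus)
      qed
      moreover have "r \<in> uminus ` ?C" using neg by (metis image_eqI minus_minus)
      ultimately have "r \<in> rel_interior (uminus ` ?C)"
        unfolding mem_rel_interior_ball affine_hull_uminus_aggregated_cone[OF u G]
        using e by blast
      then show False using disj that by blast
    qed
    moreover have "- r \<in> ?C" if "r \<notin> ?C"
    proof -
      have "r \<in> rel_interior (uminus ` ?C)" using un ru that by blast
      then have "r \<in> uminus ` ?C" using rel_interior_subset by blast
      then show ?thesis by auto
    qed
    ultimately show ?thesis using False by auto
  qed
qed

text \<open>Generic vectors are dense both in the plane and in the cone, and the cone is closed.
  Count 2 puts all generic vectors, hence the whole plane, into the cone; count 1 gives
  (ii).\<close>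

lemma condition_if_gen_count:
  assumes u: "u \<noteq> 0" and G: "G edge_of P" "edge_parallel G u"
    and c: "\<And>r. generic_in_plane u r \<Longrightarrow>
      of_bool (r \<in> aggregated_cone P u) + of_bool (- r \<in> aggregated_cone P u) = (c::nat)"
  shows "aggregated_cone P u = {x. x \<bullet> u = 0} \<or>
       (aggregated_cone P u \<inter> rel_interior (uminus ` aggregated_cone P u) = {} \<and>
        aggregated_cone P u \<union> rel_interior (uminus ` aggregated_cone P u) = {x. x \<bullet> u = 0})"
proof -
  let ?C = "aggregated_cone P u"
  note sub = aggregated_cone_subset[OF u]
  note closed = closed_aggregated_cone[OF u]
  have "normal_cone P G \<subseteq> ?C" using aggregated_cone_eq[OF u] G by blast
  moreover have "0 \<in> normal_cone P G" by (simp add: normal_cone_def)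
  \<comment> \<open>The cone contains \<open>0\<close>, so it contains a generic vector; this
    excludes \<open>c = 0\<close>.\<close>
  ultimately obtain y where "generic_in_plane u y" "y \<in> ?C"
    using aggregated_cone_gen_dense[OF u, of 0 1] by auto
  then have "c \<ge> 1" using c[of y] by simp
  obtain z where "generic_in_plane u z" using generic_in_plane_dense[OF u G, of 0 1] by auto
  then have "c \<le> 2" using c[of z] by (auto simp: of_bool_def split: if_splits)
  then consider "c = 2" | "c = 1" using \<open>c \<ge> 1\<close> by linarith
  then show ?thesis
  proof cases
    case 1
    have "x \<in> ?C" if x: "x \<bullet> u = 0" for x
    proof -
      have "\<exists>y\<in>?C. dist y x < e" if e: "e > 0" for e
      proof -
        obtain y where y: "generic_in_plane u y" "dist x y < e"
          using generic_in_plane_dense[OF u G x e] by blast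
        then have "y \<in> ?C" using c[OF y(1)] 1 by (cases "y \<in> ?C") (simp_all add: of_bool_def split: if_splits)
        with y show ?thesis by (auto simp: dist_commute)
      qed
      then show ?thesis using closed closure_approachable[of x ?C] closure_closed by blast
    qed
    then show ?thesis using sub by blast
  next
    case 2
    have hull: "affine hull (uminus ` ?C) = {x. x \<bullet> u = 0}"
      by (rule affine_hull_uminus_aggregated_cone[OF u G])
    \<comment> \<open>A common point would have a generic \<open>y\<close> of the cone nearby with
      \<open>- y\<close> in the cone as well, giving count 2.\<close>
    have "?C \<inter> rel_interior (uminus ` ?C) = {}"
    proof (rule ccontr)
      assume "\<not> ?thesis"
      then obtain x where x: "x \<in> ?C" "x \<in> rel_interior (uminus ` ?C)" by blast
      then obtain e where e: "e > 0" "ball x e \<inter> {x. x \<bullet> u = 0} \<subseteq> uminus ` ?C"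
        unfolding mem_rel_interior_ball hull by blast
      obtain y where y: "generic_in_plane u y" "y \<in> ?C" "dist x y < e"
        using aggregated_cone_gen_dense[OF u x(1) e(1)] by blast
      then have "y \<in> uminus ` ?C" using e sub by auto
      then have "- y \<in> ?C" by auto
      then show False using c[OF y(1)] y 2 by simp
    qed
    moreover have "x \<in> rel_interior (uminus ` ?C)" if x: "x \<bullet> u = 0" "x \<notin> ?C" for x
    proof -
      obtain e where e: "e > 0" "ball x e \<inter> ?C = {}"
        using closed x(2) by (metis open_Compl open_contains_ball ComplI disjoint_eq_subset_Compl)
      \<comment> \<open>Generic vectors near \<open>z\<close> miss the cone, so their negatives
        belong to it; closedness passes this on to \<open>- z\<close>.\<close>
      have in_C: "z \<in> uminus ` ?C" if z: "z \<in> ball x e" "z \<bullet> u = 0" for z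
      proof -
        obtain d where d: "d > 0" "ball z d \<subseteq> ball x e"
          using z open_contains_ball[of "ball x e"] open_ball by blast
        have "\<exists>y\<in>?C. dist y (- z) < a" if a: "a > 0" for a
        proof -
          obtain y where y: "generic_in_plane u y" "dist z y < min a d"
            using generic_in_plane_dense[OF u G z(2), of "min a d"] a d by auto
          then have "y \<notin> ?C" using d e by auto
          then have "- y \<in> ?C" using c[OF y(1)] 2 by (cases "- y \<in> ?C") simp_all
          moreover have "dist (- y) (- z) < a" using y by (simp add: dist_minus dist_commute)
          ultimately show ?thesis by blast
        qed
        then have "- z \<in> ?C" using closed closure_approachable[of "- z" ?C] closure_closed by blast
        then show ?thesis by (metis image_eqI minus_minus)
      qed
      moreover have "x \<in> uminus ` ?C" using in_C[of x] e x by simp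
      ultimately show ?thesis unfolding mem_rel_interior_ball hull using e by blast
    qed
    moreover have "rel_interior (uminus ` ?C) \<subseteq> {x. x \<bullet> u = 0}"
      using rel_interior_subset hull_subset[of "uminus ` ?C" affine] unfolding hull by (rule order_trans)
    ultimately show ?thesis using sub by blast
  qed
qed

section \<open>Perturbing \<open>u\<close> into two generic directions\<close>

text \<open>Adding or subtracting \<open>\<delta>\<close> times \<open>m\<close> then leaves the
  sign of \<open>u\<close> on every facet normal not orthogonal to it unchanged. Finitely many
  facets allow a common \<open>\<delta>\<close>.\<close>

lemma small_perturbation:
  obtains \<delta> where "\<delta> > 0"
    "\<And>F. F facet_of P \<Longrightarrow> u \<bullet> facet_normal F \<noteq> 0 \<Longrightarrow> \<bar>\<delta> * (m \<bullet> facet_normal F)\<bar> < \<bar>u \<bullet> facet_normal F\<bar>"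
proof -
  have "\<forall>\<^sub>F \<delta> in at_right 0. \<bar>\<delta> * (m \<bullet> facet_normal F)\<bar> < \<bar>u \<bullet> facet_normal F\<bar>"
    if "u \<bullet> facet_normal F \<noteq> 0" for F
  proof (rule order_tendstoD(2))
    show "((\<lambda>\<delta>. \<bar>\<delta> * (m \<bullet> facet_normal F)\<bar>) \<longlongrightarrow> 0) (at_right 0)"
      by (auto intro!: tendsto_eq_intros)
  qed (use that in simp)
  then have "\<forall>\<^sub>F \<delta> in at_right 0. \<forall>F\<in>{F. F facet_of P}.
      u \<bullet> facet_normal F \<noteq> 0 \<longrightarrow> \<bar>\<delta> * (m \<bullet> facet_normal F)\<bar> < \<bar>u \<bullet> facet_normal F\<bar>"
    using finite_polytope_facets[OF polytope]
    by (intro eventually_ball_finite) (auto simp: eventually_mono)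
  moreover have "\<forall>\<^sub>F \<delta> in at_right 0. \<delta> > (0::real)" by (rule eventually_at_right_less)
  ultimately have "\<forall>\<^sub>F \<delta> in at_right 0. \<delta> > 0 \<and> (\<forall>F. F facet_of P \<longrightarrow>
      u \<bullet> facet_normal F \<noteq> 0 \<longrightarrow> \<bar>\<delta> * (m \<bullet> facet_normal F)\<bar> < \<bar>u \<bullet> facet_normal F\<bar>)"
    by eventually_elim auto
  then obtain \<delta> where "\<delta> > 0 \<and> (\<forall>F. F facet_of P \<longrightarrow>
      u \<bullet> facet_normal F \<noteq> 0 \<longrightarrow> \<bar>\<delta> * (m \<bullet> facet_normal F)\<bar> < \<bar>u \<bullet> facet_normal F\<bar>)"
    using eventually_happens'[of "at_right (0::real)"] by auto
  then show ?thesis using that by blast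
qed

lemma gen_count_constant:
  assumes u: "u \<noteq> 0" and G0: "G0 edge_of P" "edge_parallel G0 u"
    and k: "\<And>n. generic_direction n \<Longrightarrow> card (silhouette n) = k"
  obtains c :: nat where "\<And>r. generic_in_plane u r \<Longrightarrow>
      of_bool (r \<in> aggregated_cone P u) + of_bool (- r \<in> aggregated_cone P u) = c"
proof -
  let ?C = "aggregated_cone P u"
  let ?E = "{G. G edge_of P \<and> \<not> edge_parallel G u}"
  have "\<forall>G. \<exists>F1 F2. G edge_of P \<longrightarrow> F1 facet_of P \<and> F2 facet_of P \<and> F1 \<noteq> F2 \<and> G = F1 \<inter> F2"
    using edge_eq_Int_facets by metis
  then obtain f g where fg: "\<And>G. G edge_of P \<Longrightarrow>
      f G facet_of P \<and> g G facet_of P \<and> f G \<noteq> g G \<and> G = f G \<inter> g G"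
    by metis
  define w where "w G = (u \<bullet> facet_normal (f G)) * (u \<bullet> facet_normal (g G))" for G
  \<comment> \<open>The total that the edges not parallel to \<open>u\<close> contribute to the two
    perturbed silhouettes; it does not involve \<open>r\<close>.\<close>
  define K where "K = (\<Sum>G\<in>?E. if w G < 0 then 2 else if w G = 0 then 1 else 0 :: nat)"
  have finE: "finite ?E" using finite_edges by simp
  have main: "2 * (of_bool (r \<in> ?C) + of_bool (- r \<in> ?C)) + K = 2 * k" if r: "generic_in_plane u r" for r
  proof -
    let ?m = "r \<times> u"
    obtain \<delta> where \<delta>: "\<delta> > 0"
      "\<And>F. F facet_of P \<Longrightarrow> u \<bullet> facet_normal F \<noteq> 0 \<Longrightarrow> \<bar>\<delta> * (?m \<bullet> facet_normal F)\<bar> < \<bar>u \<bullet> facet_normal F\<bar>"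
      using small_perturbation[of u ?m] by blast
    define n n' where "n = u + \<delta> *\<^sub>R ?m" and "n' = u - \<delta> *\<^sub>R ?m"
    have n: "n \<bullet> x = u \<bullet> x + \<delta> * (?m \<bullet> x)" "n' \<bullet> x = u \<bullet> x - \<delta> * (?m \<bullet> x)" for x
      by (auto simp: n_def n'_def inner_add_left inner_diff_left)
    have nz: "\<delta> * (?m \<bullet> facet_normal F) \<noteq> 0" if "F facet_of P" "u \<bullet> facet_normal F = 0" for F
      using that r \<delta> by (auto simp: generic_in_plane_def)
    have gen: "generic_direction n" "generic_direction n'"
      unfolding generic_direction_def n using \<delta>(2) nz by (smt (verit))+
    \<comment> \<open>Hence \<open>u \<times> n\<close> and \<open>u \<times> n'\<close> are
      positive multiples of \<open>r\<close> and \<open>- r\<close>, so both directions see the same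
      number of edges parallel to \<open>u\<close>.\<close>
    have "u \<times> ?m = (u \<bullet> u) *\<^sub>R r"
      using r by (simp add: Lagrange generic_in_plane_def inner_commute)
    then have cross: "u \<times> n = (\<delta> * (u \<bullet> u)) *\<^sub>R r" "u \<times> n' = (\<delta> * (u \<bullet> u)) *\<^sub>R (- r)"
      by (auto simp: n_def n'_def cross_add_right Cross3.right_diff_distrib cross_mult_right)
    have pos: "\<delta> * (u \<bullet> u) > 0" using u \<delta> by simp
    have card_eq: "k = of_bool (u \<times> n \<in> ?C) + of_bool (- (u \<times> n) \<in> ?C)
        + (\<Sum>G\<in>?E. of_bool (G \<in> silhouette n))" if n: "generic_direction n" for n
    proof -
      have "silhouette n = {G \<in> silhouette n. edge_parallel G u} \<union> (?E \<inter> {G. G \<in> silhouette n})"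
        by (auto simp: silhouette_def)
      then have "card (silhouette n) =
          card {G \<in> silhouette n. edge_parallel G u} + card (?E \<inter> {G. G \<in> silhouette n})"
        using card_Un_disjoint[of "{G \<in> silhouette n. edge_parallel G u}" "?E \<inter> {G. G \<in> silhouette n}"]
          finite_silhouette finE by auto
      moreover have "(\<Sum>G\<in>?E. of_bool (G \<in> silhouette n)) = card (?E \<inter> {G. G \<in> silhouette n})"
        using finE by (simp add: sum_of_bool_eq)
      ultimately show ?thesis
        using card_silhouette_par[OF u G0 generic_in_plane_cross[OF n u]] k[OF n]
        by simp
    qed
    have "of_bool (G \<in> silhouette n) + of_bool (G \<in> silhouette n') =
        (if w G < 0 then 2 else if w G = 0 then 1 else 0 :: nat)" if "G \<in> ?E" for G
    proof -
      have G: "G edge_of P" "\<not> edge_parallel G u" using that by auto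
      have fG: "f G facet_of P" "g G facet_of P" "f G \<noteq> g G" "G = f G \<inter> g G" using fg G by auto
      have "u \<bullet> facet_normal (f G) \<noteq> 0 \<or> u \<bullet> facet_normal (g G) \<noteq> 0"
        using edge_parallel_if_orth_facets[OF G(1) fG u] G by blast
      then show ?thesis
        unfolding mem_silhouette_iff[OF gen(1) G(1) fG] mem_silhouette_iff[OF gen(2) G(1) fG] n w_def
        using \<delta>(2) nz fG by (intro sign_change_pair_count) auto
    qed
    then have "(\<Sum>G\<in>?E. of_bool (G \<in> silhouette n)) + (\<Sum>G\<in>?E. of_bool (G \<in> silhouette n')) = K"
      unfolding K_def sum.distrib[symmetric] by (intro sum.cong) auto
    moreover have "u \<times> n \<in> ?C \<longleftrightarrow> r \<in> ?C" "- (u \<times> n) \<in> ?C \<longleftrightarrow> - r \<in> ?C"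
      "u \<times> n' \<in> ?C \<longleftrightarrow> - r \<in> ?C" "- (u \<times> n') \<in> ?C \<longleftrightarrow> r \<in> ?C"
      using aggregated_cone_scaleR[OF u pos, of r] aggregated_cone_scaleR[OF u pos, of "- r"]
      unfolding cross by auto
    ultimately show ?thesis using card_eq[OF gen(1)] card_eq[OF gen(2)] by simp
  qed
  \<comment> \<open>Solving \<open>main\<close> for the count; the subtraction of naturals does not
    truncate, as \<open>main\<close> gives \<open>K \<le> 2 * k\<close>.\<close>
  have "of_bool (r \<in> ?C) + of_bool (- r \<in> ?C) = (2 * k - K) div 2" if "generic_in_plane u r" for r
  proof -
    have "2 * k - K = 2 * (of_bool (r \<in> ?C) + of_bool (- r \<in> ?C))" using main[OF that] by linarith
    then show ?thesis by simp
  qed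
  then show ?thesis using that by blast
qed

end

theorem theorem1p2:
  fixes P :: "(real^3) set"
  assumes "polytope P" and "aff_dim P = 3"
  shows "equiprojective P \<longleftrightarrow>
    (\<forall>u. edge_direction P u \<longrightarrow>
       aggregated_cone P u = {x. x \<bullet> u = 0} \<or>
       (aggregated_cone P u \<inter> rel_interior (uminus ` aggregated_cone P u) = {} \<and>
        aggregated_cone P u \<union> rel_interior (uminus ` aggregated_cone P u) = {x. x \<bullet> u = 0}))"
    (is "_ \<longleftrightarrow> (\<forall>u. _ \<longrightarrow> ?cond u)")
proof -
  interpret polytope3 P by unfold_locales (fact assms)+
  show ?thesis
  proof (intro iffI allI impI)
    fix u assume "equiprojective P" and u: "edge_direction P u"
    then obtain k where k: "\<And>n. generic_direction n \<Longrightarrow> card (silhouette n) = k"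
      using equiprojective_iff by blast
    have "u \<noteq> 0" using u by (auto simp: edge_direction_iff)
    obtain G where G: "G edge_of P" "edge_parallel G u" using u by (auto simp: edge_direction_iff)
    obtain c :: nat where "\<And>r. generic_in_plane u r \<Longrightarrow>
        of_bool (r \<in> aggregated_cone P u) + of_bool (- r \<in> aggregated_cone P u) = c"
      using gen_count_constant[OF \<open>u \<noteq> 0\<close> G k] by blast
    then show "?cond u" by (rule condition_if_gen_count[OF \<open>u \<noteq> 0\<close> G])
  next
    assume cond: "\<forall>u. edge_direction P u \<longrightarrow> ?cond u"
    \<comment> \<open>Each edge direction contributes a number independent of \<open>n\<close>, so
      the sum over all edge directions is the required constant.\<close>
    have "card {G \<in> silhouette n. edge_parallel G u} = (if aggregated_cone P u = {x. x \<bullet> u = 0} then 2 else 1)"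
      if n: "generic_direction n" and u: "edge_direction P u" for n u
    proof -
      have "u \<noteq> 0" using u by (auto simp: edge_direction_iff)
      obtain G where G: "G edge_of P" "edge_parallel G u" using u by (auto simp: edge_direction_iff)
      have gen: "generic_in_plane u (u \<times> n)" using generic_in_plane_cross n \<open>u \<noteq> 0\<close> by blast
      have "?cond u" using cond u by blast
      then show ?thesis
        using card_silhouette_par[OF \<open>u \<noteq> 0\<close> G gen]
          gen_count_if_condition[OF \<open>u \<noteq> 0\<close> G gen] by simp
    qed
    then have "card (silhouette n) =
        (\<Sum>u | edge_direction P u. if aggregated_cone P u = {x. x \<bullet> u = 0} then 2 else 1)"
      if "generic_direction n" for n
      unfolding card_silhouette_sum using that by (intro sum.cong) auto
    then show "equiprojective P" unfolding equiprojective_iff by blast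
  qed
qed

end
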